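(* Let $n\ge2$, let $(\mathfrak{h},\eta,\omega)$ be a cosymplectic Lie algebra of dimension $2n-1$ with Reeb vector $R$, endowed with a derivation $D$ such that $D^*\omega=\alpha\omega$ for some real $\alpha\neq 0$. Put $\mathfrak{g}=\mathfrak{h}\rtimes_D\mathbb{R}$, define $\vartheta\in\mathfrak{g}^*$ by $\vartheta(X,a)=-\alpha a$, extend $\eta,\omega$ to $\mathfrak{g}$ by pulling back along the linear projection $(X,a)\mapsto X$, and set $\Omega=\omega+\eta\wedge\vartheta$. Then: (1) $(\Omega,\vartheta)$ is an lcs structure on $\mathfrak{g}$. (2) The Lie algebra $\mathfrak{g}$ is unimodular if and only if $\mathfrak{h}$ is unimodular and $D^*\eta=-\alpha(n-1)\eta+\zeta$ for some $\zeta\in\langle R\rangle^\circ$. (3) If $\mathfrak{h}$ is unimodular, then the lcs structure $(\Omega,\vartheta)$ on $\mathfrak{g}$ is not exact.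
   Context: All Lie algebras are real and finite-dimensional; $d$ is the Chevalley–Eilenberg differential. An lcs structure on a Lie algebra $\mathfrak{g}$ of dimension $2n\ge4$ is a pair $(\Omega,\vartheta)\in\Lambda^2\mathfrak{g}^*\times\mathfrak{g}^*$ with $\Omega^n\ne0$, $d\vartheta=0$, $d\Omega=\vartheta\wedge\Omega$; it is exact if $\Omega=d\upsilon-\vartheta\wedge\upsilon$ for some $\upsilon\in\mathfrak{g}^*$. A cosymplectic structure on a $(2n-1)$-dimensional Lie algebra $\mathfrak{h}$ is a pair $(\eta,\omega)\in\mathfrak{h}^*\times\Lambda^2\mathfrak{h}^*$ with $d\eta=0$, $d\omega=0$, $\eta\wedge\omega^{n-1}\ne0$; its Reeb vector $R\in\mathfrak{h}$ is determined by $\imath_R\omega=0$, $\eta(R)=1$. $\langle R\rangle^\circ\subset\mathfrak{h}^*$ is the annihilator of $\langle R\rangle$. For a linear map $D:\mathfrak{h}\to\mathfrak{h}$, $(D^*\eta)(X)=\eta(DX)$ and $(D^*\omega)(X,Y)=\omega(DX,Y)+\omega(X,DY)$. The semidirect product $\mathfrak{h}\rtimes_D\mathbb{R}$ is $\mathfrak{h}\oplus\mathbb{R}$ with bracket $[(X,a),(Y,b)]=(aD(Y)-bD(X)+[X,Y]_{\mathfrak{h}},0)$. A Lie algebra is unimodular if $\operatorname{tr}(\mathrm{ad}_X)=0$ for all $X$. *)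

theory Defs
  imports "HOL-Analysis.Analysis" "HOL-Combinatorics.Permutations"
begin

definition fd_lie_algebra :: "('a::real_vector \<Rightarrow> 'a \<Rightarrow> 'a) \<Rightarrow> bool" where
  "fd_lie_algebra br \<longleftrightarrow>
     (\<exists>B::'a set. finite B \<and> span B = UNIV) \<and>
     bilinear br \<and>
     (\<forall>x. br x x = 0) \<and>
     (\<forall>x y z. br x (br y z) + br y (br z x) + br z (br x y) = 0)"

definition lie_derivation :: "('a::real_vector \<Rightarrow> 'a \<Rightarrow> 'a) \<Rightarrow> ('a \<Rightarrow> 'a) \<Rightarrow> bool" where
  "lie_derivation br D \<longleftrightarrow>
     linear D \<and> (\<forall>x y. D (br x y) = br (D x) y + br x (D y))"

text \<open>Computed in a chosen basis; the value does not depend on the choice.\<close>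

definition lin_trace :: "('a::real_vector \<Rightarrow> 'a) \<Rightarrow> real" where
  "lin_trace f =
     (let B = (SOME B. independent B \<and> span B = UNIV) in \<Sum>b\<in>B. representation B (f b) b)"

definition unimodular_lie :: "('a::real_vector \<Rightarrow> 'a \<Rightarrow> 'a) \<Rightarrow> bool" where
  "unimodular_lie br \<longleftrightarrow> (\<forall>x. lin_trace (br x) = 0)"

definition semidirect_bracket ::
  "('a::real_vector \<Rightarrow> 'a \<Rightarrow> 'a) \<Rightarrow> ('a \<Rightarrow> 'a) \<Rightarrow> 'a \<times> real \<Rightarrow> 'a \<times> real \<Rightarrow> 'a \<times> real" where
  "semidirect_bracket br D = (\<lambda>(X, a) (Y, b). (a *\<^sub>R D Y - b *\<^sub>R D X + br X Y, 0))"

text \<open>A form on \<open>'a\<close> is a function on argument lists. A \<open>k\<close>-form vanishes on all lists whose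
  length is not \<open>k\<close>, so that equality of \<open>k\<close>-forms is equality of functions, the zero form is
  \<open>\<lambda>_. 0\<close>, and the operations below need no degree arguments.\<close>

definition alt_form :: "nat \<Rightarrow> ('a::real_vector list \<Rightarrow> real) \<Rightarrow> bool" where
  "alt_form k \<phi> \<longleftrightarrow>
     (\<forall>xs. length xs \<noteq> k \<longrightarrow> \<phi> xs = 0) \<and>
     (\<forall>xs i. length xs = k \<and> i < k \<longrightarrow> linear (\<lambda>x. \<phi> (xs[i := x]))) \<and>
     (\<forall>xs i j. length xs = k \<and> i < j \<and> j < k \<and> xs ! i = xs ! j \<longrightarrow> \<phi> xs = 0)"

definition covector_form :: "('a \<Rightarrow> real) \<Rightarrow> 'a list \<Rightarrow> real" where
  "covector_form f xs = (if length xs = 1 then f (hd xs) else 0)"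

text \<open>On a \<open>p\<close>-form and a \<open>q\<close>-form only the \<open>p\<close>-th summand at lists of length \<open>p + q\<close> survives.
  With this normalisation \<open>(\<phi> \<and> \<psi>)(X, Y) = \<phi>(X) \<psi>(Y) - \<phi>(Y) \<psi>(X)\<close> for 1-forms.\<close>

definition wedge_form :: "('a list \<Rightarrow> real) \<Rightarrow> ('a list \<Rightarrow> real) \<Rightarrow> 'a list \<Rightarrow> real" where
  "wedge_form \<phi> \<psi> xs =
     (\<Sum>p\<le>length xs. (\<Sum>\<sigma> | \<sigma> permutes {..<length xs}.
        of_int (sign \<sigma>) * \<phi> (take p (permute_list \<sigma> xs)) * \<psi> (drop p (permute_list \<sigma> xs)))
        / (fact p * fact (length xs - p)))"

fun wedge_power :: "('a list \<Rightarrow> real) \<Rightarrow> nat \<Rightarrow> 'a list \<Rightarrow> real" where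
  "wedge_power \<phi> 0 = (\<lambda>xs. if xs = [] then 1 else 0)"
| "wedge_power \<phi> (Suc m) = wedge_form \<phi> (wedge_power \<phi> m)"

text \<open>The Chevalley--Eilenberg differential
  \<open>d\<phi>(x\<^sub>0, \<dots>, x\<^sub>k) = \<Sum>\<^bsub>i < j\<^esub> (-1)\<^bsup>i + j\<^esup> \<phi>([x\<^sub>i, x\<^sub>j], x\<^sub>0, \<dots>, x\<^sub>k)\<close>, where \<open>x\<^sub>i\<close> and \<open>x\<^sub>j\<close> are
  left out of the trailing arguments.\<close>

definition ce_diff ::
  "('a \<Rightarrow> 'a \<Rightarrow> 'a) \<Rightarrow> ('a list \<Rightarrow> real) \<Rightarrow> 'a list \<Rightarrow> real" where
  "ce_diff br \<phi> xs =
     (\<Sum>j<length xs. \<Sum>i<j. (-1) ^ (i + j) * \<phi> (br (xs ! i) (xs ! j) # nths xs (- {i, j})))"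

definition interior_form :: "'a \<Rightarrow> ('a list \<Rightarrow> real) \<Rightarrow> 'a list \<Rightarrow> real" where
  "interior_form x \<phi> xs = \<phi> (x # xs)"

definition pullback_form :: "('a \<Rightarrow> 'b) \<Rightarrow> ('b list \<Rightarrow> real) \<Rightarrow> 'a list \<Rightarrow> real" where
  "pullback_form f \<phi> xs = \<phi> (map f xs)"

text \<open>The action written \<open>D\<^sup>*\<close>: it extends \<open>D\<close> to forms as a derivation and is not the pullback
  along \<open>D\<close>.\<close>

definition derivation_action :: "('a \<Rightarrow> 'a) \<Rightarrow> ('a list \<Rightarrow> real) \<Rightarrow> 'a list \<Rightarrow> real" where
  "derivation_action D \<phi> xs = (\<Sum>i<length xs. \<phi> (xs[i := D (xs ! i)]))"

lemma derivation_action_1: "derivation_action D \<eta> [X] = \<eta> [D X]"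
  by (simp add: derivation_action_def)

lemma derivation_action_2: "derivation_action D \<omega> [X, Y] = \<omega> [D X, Y] + \<omega> [X, D Y]"
  by (simp add: derivation_action_def numeral_2_eq_2)

definition annihilator_forms :: "'a::real_vector set \<Rightarrow> ('a list \<Rightarrow> real) set" where
  "annihilator_forms S = {\<zeta>. alt_form 1 \<zeta> \<and> (\<forall>x\<in>S. \<zeta> [x] = 0)}"

text \<open>The dimension \<open>2n - 1\<close> is written without truncated subtraction.\<close>

definition cosymplectic_structure ::
  "nat \<Rightarrow> ('a::real_vector \<Rightarrow> 'a \<Rightarrow> 'a) \<Rightarrow> ('a list \<Rightarrow> real) \<Rightarrow> ('a list \<Rightarrow> real) \<Rightarrow> bool" where
  "cosymplectic_structure n br \<eta> \<omega> \<longleftrightarrow>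
     fd_lie_algebra br \<and> dim (UNIV :: 'a set) + 1 = 2 * n \<and>
     alt_form 1 \<eta> \<and> alt_form 2 \<omega> \<and>
     ce_diff br \<eta> = (\<lambda>_. 0) \<and> ce_diff br \<omega> = (\<lambda>_. 0) \<and>
     wedge_form \<eta> (wedge_power \<omega> (n - 1)) \<noteq> (\<lambda>_. 0)"

definition reeb_vector :: "('a list \<Rightarrow> real) \<Rightarrow> ('a list \<Rightarrow> real) \<Rightarrow> 'a \<Rightarrow> bool" where
  "reeb_vector \<eta> \<omega> R \<longleftrightarrow> interior_form R \<omega> = (\<lambda>_. 0) \<and> \<eta> [R] = 1"

definition lcs_structure ::
  "nat \<Rightarrow> ('a::real_vector \<Rightarrow> 'a \<Rightarrow> 'a) \<Rightarrow> ('a list \<Rightarrow> real) \<Rightarrow> ('a list \<Rightarrow> real) \<Rightarrow> bool" where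
  "lcs_structure n br \<Omega> \<theta> \<longleftrightarrow>
     fd_lie_algebra br \<and> n \<ge> 2 \<and> dim (UNIV :: 'a set) = 2 * n \<and>
     alt_form 2 \<Omega> \<and> alt_form 1 \<theta> \<and>
     wedge_power \<Omega> n \<noteq> (\<lambda>_. 0) \<and>
     ce_diff br \<theta> = (\<lambda>_. 0) \<and> ce_diff br \<Omega> = wedge_form \<theta> \<Omega>"

definition lcs_exact ::
  "('a::real_vector \<Rightarrow> 'a \<Rightarrow> 'a) \<Rightarrow> ('a list \<Rightarrow> real) \<Rightarrow> ('a list \<Rightarrow> real) \<Rightarrow> bool" where
  "lcs_exact br \<Omega> \<theta> \<longleftrightarrow>
     (\<exists>\<upsilon>. alt_form 1 \<upsilon> \<and> \<Omega> = (\<lambda>xs. ce_diff br \<upsilon> xs - wedge_form \<theta> \<upsilon> xs))"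

end

theory Submission
  imports Defs
begin

text \<open>
  (2) and (3) rest on one trace formula: if \<open>\<omega>(Dx, y) + \<omega>(x, Dy) = a \<omega>(x, y)\<close> for a linear map
  \<open>D\<close> of \<open>h\<close>, then \<open>tr D = (n - 1) a + \<eta>(D R)\<close>, because \<open>D\<close> preserves the kernel of \<open>\<omega>\<close> and
  is conformally symplectic on the quotient. For the given derivation this is (2), since the traces
  of the adjoint maps of the semidirect product are those of \<open>h\<close> together with multiples of
  \<open>tr D\<close>. For (3), exactness gives \<open>\<omega>(x, y) = - \<upsilon>([x, y])\<close> on \<open>h\<close>. Let \<open>x\<^sub>0\<close> represent
  \<open>\<upsilon> - \<upsilon>(R) \<eta>\<close> through \<open>\<omega>\<close>; this covector agrees with \<open>\<upsilon>\<close> on commutators, so closedness of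
  \<open>\<omega>\<close> makes \<open>ad x\<^sub>0\<close> conformal with \<open>a = - 1\<close>, and \<open>tr ad x\<^sub>0 = 1 - n \<noteq> 0\<close>. In (1) the point is
  \<open>\<Omega>\<^sup>n \<noteq> 0\<close>: as the interior product is an antiderivation, contracting \<open>\<Omega>\<^sup>n\<close> with \<open>(0, 1)\<close> and
  restricting to \<open>h\<close> gives \<open>n \<alpha> \<eta> \<and> \<omega>\<^sup>n\<^sup>-\<^sup>1\<close>.
\<close>

section \<open>Wedge products of alternating forms\<close>

lemma alt_form_linear:
  assumes "alt_form k \<phi>" "length xs = k" "i < k"
  shows "linear (\<lambda>x. \<phi> (xs[i := x]))"
  using assms unfolding alt_form_def by blast

lemma permute_list_transpose:
  assumes "i < length xs" "j < length xs"
  shows "permute_list (Transposition.transpose i j) xs = xs[i := xs ! j, j := xs ! i]"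
  by (rule nth_equalityI) (use assms in \<open>simp_all add: permute_list_def Transposition.transpose_def\<close>)

text \<open>Polarization: as a function of the entries at \<open>i\<close> and \<open>j\<close> the
  form is bilinear and vanishes on the diagonal, so expanding its zero value at (u + v, u + v) gives
  antisymmetry.\<close>

lemma alt_form_transpose:
  assumes "alt_form k \<phi>" "length xs = k" "i < k" "j < k" "i \<noteq> j"
  shows "\<phi> (permute_list (Transposition.transpose i j) xs) = - \<phi> xs"
proof -
  define f where "f u v = \<phi> (xs[i := u, j := v])" for u v
  have fl: "linear (\<lambda>u. f u v)" for v
  proof -
    have "linear (\<lambda>u. \<phi> ((xs[j := v])[i := u]))"
      using assms by (intro alt_form_linear) auto
    then show ?thesis
      using assms(5) by (simp add: f_def list_update_swap)
  qed
  have fr: "linear (\<lambda>v. f u v)" for u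
    unfolding f_def using assms by (intro alt_form_linear) auto
  have fd: "f u u = 0" for u
  proof -
    have *: "\<And>ys i j. length ys = k \<Longrightarrow> i < j \<Longrightarrow> j < k \<Longrightarrow> ys ! i = ys ! j \<Longrightarrow> \<phi> ys = 0"
      using assms(1) unfolding alt_form_def by blast
    have "(xs[i := u, j := u]) ! i = (xs[i := u, j := u]) ! j"
      using assms by (simp add: nth_list_update)
    then show ?thesis
      unfolding f_def
      using *[of "xs[i := u, j := u]" i j] *[of "xs[i := u, j := u]" j i] assms
      by (cases "i < j") auto
  qed
  have "f (u + v) (u + v) = f u u + f u v + f v u + f v v" for u v
    using linear_add[OF fl] linear_add[OF fr] by simp
  then have "f (xs ! j) (xs ! i) = - f (xs ! i) (xs ! j)"
    using fd by (smt (verit))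
  moreover have "f (xs ! i) (xs ! j) = \<phi> xs"
    by (simp add: f_def)
  ultimately show ?thesis
    using assms by (simp add: permute_list_transpose f_def)
qed

text \<open>Every permutation is a product of transpositions, each of which contributes one
  sign.\<close>

lemma alt_form_permute_list:
  assumes "alt_form k \<phi>" "length xs = k" "\<sigma> permutes {..<k}"
  shows "\<phi> (permute_list \<sigma> xs) = of_int (sign \<sigma>) * \<phi> xs"
  using finite_lessThan assms(3)
proof (induction rule: permutes_rev_induct)
  case id
  show ?case by simp
next
  case (swap a b p)
  have "permute_list (p \<circ> Transposition.transpose a b) xs =
      permute_list (Transposition.transpose a b) (permute_list p xs)"
    using swap.hyps assms by (intro permute_list_compose permutes_swap_id) auto
  then have "\<phi> (permute_list (p \<circ> Transposition.transpose a b) xs) = - \<phi> (permute_list p xs)"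
    using alt_form_transpose[OF assms(1), of "permute_list p xs" a b] assms(2) swap.hyps by simp
  moreover have "permutation p"
    using swap.hyps permutation_permutes by blast
  then have "sign (p \<circ> Transposition.transpose a b) = - sign p"
    using swap.hyps by (simp only: sign_compose permutation_swap_id sign_swap_id) simp
  ultimately show ?case
    using swap.IH by (simp del: o_apply comp_apply)
qed

section \<open>Permutations sorted by the place that receives the first argument\<close>

text \<open>A permutation \<open>\<sigma>\<close> of \<open>{..<N + 1}\<close> is determined by \<open>k = \<sigma>\<^sup>-\<^sup>1 0\<close> and a permutation of the other
  \<open>N\<close> arguments. How the \<open>k\<close>-th position is brought to the front is left open, so that it can be
  adapted to the block of a wedge product containing \<open>k\<close>.\<close>

lemma sum_permutes_lessThan_Suc:
  assumes "\<And>k. k \<le> N \<Longrightarrow> \<rho> k permutes {..<Suc N}" "\<And>k. k \<le> N \<Longrightarrow> \<rho> k k = 0"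
  shows "(\<Sum>\<sigma> | \<sigma> permutes {..<Suc N}. F \<sigma>) =
    (\<Sum>k\<le>N. \<Sum>\<tau> | \<tau> permutes {..<N}. F (map_permutation {..<N} Suc \<tau> \<circ> \<rho> k))"
proof -
  let ?S = "\<lambda>n::nat. {\<sigma>. \<sigma> permutes {..<n}}"
  let ?M = "map_permutation {..<N} Suc"
  let ?h = "\<lambda>(k, \<tau>). ?M \<tau> \<circ> \<rho> k"
  have fin: "finite (?S n)" for n
    by (simp add: finite_permutations)
  have M: "?M \<tau> permutes Suc ` {..<N}" if "\<tau> permutes {..<N}" for \<tau>
    using that by (intro map_permutation_permutes) (auto simp: bij_betw_def)
  have M0: "?M \<tau> 0 = 0" if "\<tau> permutes {..<N}" for \<tau>
    using M[OF that] by (auto simp: permutes_not_in)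
  have MSuc: "?M \<tau> permutes {..<Suc N}" if "\<tau> permutes {..<N}" for \<tau>
    using M[OF that] by (rule permutes_subset) auto
  have Minj: "\<tau> = \<tau>'" if "\<tau> permutes {..<N}" "\<tau>' permutes {..<N}" "?M \<tau> = ?M \<tau>'" for \<tau> \<tau>'
  proof
    fix i
    show "\<tau> i = \<tau>' i"
    proof (cases "i < N")
      case True
      then have "Suc (\<tau> i) = Suc (\<tau>' i)"
        using that(3) map_permutation_apply[of Suc "{..<N}" i] by (metis inj_Suc inj_on_subset lessThan_iff subset_UNIV)
      then show ?thesis by simp
    next
      case False
      then show ?thesis
        using that by (simp add: permutes_not_in)
    qed
  qed
  have inj: "inj_on ?h ({..N} \<times> ?S N)"
  proof (rule inj_onI, clarsimp)
    fix k \<tau> k' \<tau>'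
    assume *: "k \<le> N" "\<tau> permutes {..<N}" "k' \<le> N" "\<tau>' permutes {..<N}"
      "?M \<tau> \<circ> \<rho> k = ?M \<tau>' \<circ> \<rho> k'"
    \<comment> \<open>Both compositions agree at \<open>k\<close>, and the left one sends
      \<open>k\<close> to 0, since \<open>\<rho> k k = 0\<close> and the shifted permutation fixes
      0. Thus \<open>k\<close> is recovered as the preimage of 0.\<close>
    have "?M \<tau>' (\<rho> k' k) = ?M \<tau>' 0"
      using fun_cong[OF *(5), of k] M0[OF *(2)] M0[OF *(4)] assms(2)[OF *(1)] by simp
    then have "\<rho> k' k = \<rho> k' k'"
      using permutes_inj[OF MSuc[OF *(4)]] assms(2)[OF *(3)] by (simp add: inj_eq)
    then have k: "k = k'"
      using permutes_inj[OF assms(1)[OF *(3)]] by (simp add: inj_eq)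
    have "?M \<tau> = ?M \<tau>'"
      using *(5) permutes_surj[OF assms(1)[OF *(1)]] unfolding k by (metis surj_fun_eq)
    then show "k = k' \<and> \<tau> = \<tau>'"
      using k Minj * by blast
  qed
  have sub: "?h ` ({..N} \<times> ?S N) \<subseteq> ?S (Suc N)"
    using permutes_compose[OF assms(1) MSuc] by auto
  \<comment> \<open>Counting replaces a proof of surjectivity: (N + 1) * N! = (N + 1)!.\<close>
  have "card (?h ` ({..N} \<times> ?S N)) = card (?S (Suc N))"
    by (simp add: card_image[OF inj] card_cartesian_product card_permutations[OF refl] del: lessThan_Suc)
  then have "?h ` ({..N} \<times> ?S N) = ?S (Suc N)"
    using sub fin by (intro card_subset_eq) auto
  then have "(\<Sum>\<sigma> \<in> ?S (Suc N). F \<sigma>) = (\<Sum>x\<in>{..N} \<times> ?S N. F (?h x))"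
    using sum.reindex[OF inj, of F] by (simp only: o_def)
  also have "\<dots> = (\<Sum>k\<le>N. \<Sum>\<tau> \<in> ?S N. F (?M \<tau> \<circ> \<rho> k))"
    by (simp add: sum.cartesian_product case_prod_unfold)
  finally show ?thesis .
qed

text \<open>Conjugation by \<open>Suc\<close> lets \<tau> act on the tail and fixes position 0,
  which holds \<open>x\<close>.\<close>

lemma permute_list_map_permutation_Suc:
  assumes "\<tau> permutes {..<length xs}"
  shows "permute_list (map_permutation {..<length xs} Suc \<tau>) (x # xs) = x # permute_list \<tau> xs"
proof (rule nth_equalityI)
  let ?M = "map_permutation {..<length xs} Suc \<tau>"
  have M: "?M permutes Suc ` {..<length xs}"
    using assms by (intro map_permutation_permutes) (auto simp: bij_betw_def)
  then have M': "?M permutes {..<length (x # xs)}"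
    by (rule permutes_subset) auto
  fix i assume i: "i < length (permute_list ?M (x # xs))"
  show "permute_list ?M (x # xs) ! i = (x # permute_list \<tau> xs) ! i"
  proof (cases i)
    case 0
    then show ?thesis
      using M by (auto simp: permute_list_nth[OF M'] permutes_not_in)
  next
    case (Suc j)
    then have "?M i = Suc (\<tau> j)"
      using i by (auto simp: map_permutation_apply)
    then show ?thesis
      using i Suc by (subst permute_list_nth[OF M']) (auto simp: permute_list_nth[OF assms])
  qed
qed simp

text \<open>The cycle 0 -> 1 -> ... -> p -> 0. As \<open>permute_list\<close> puts entry
  \<open>\<sigma> i\<close> at place \<open>i\<close>, it moves the head of a list to place
  \<open>p\<close> and shifts the entries passed over one place to the front.\<close>

definition insertion_cycle :: "nat \<Rightarrow> nat \<Rightarrow> nat" where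
  "insertion_cycle p i = (if i < p then Suc i else if i = p then 0 else i)"

text \<open>Splits off one adjacent transposition per step of an induction on \<open>p\<close>; this
  gives both that the cycle is a permutation and that its sign is (- 1)^p.\<close>

lemma insertion_cycle_Suc: "insertion_cycle (Suc p) = insertion_cycle p \<circ> Transposition.transpose p (Suc p)"
  by (auto simp: fun_eq_iff insertion_cycle_def Transposition.transpose_def)

lemma insertion_cycle_permutes: "insertion_cycle p permutes {..p}"
proof (induction p)
  case 0
  have "insertion_cycle 0 = id"
    by (auto simp: fun_eq_iff insertion_cycle_def)
  then show ?case
    by (simp only: permutes_id)
next
  case (Suc p)
  have "insertion_cycle p permutes {..Suc p}"
    using Suc by (rule permutes_subset) auto
  then show ?case
    unfolding insertion_cycle_Suc by (intro permutes_compose permutes_swap_id) auto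
qed

lemma sign_insertion_cycle: "sign (insertion_cycle p) = (- 1) ^ p"
proof (induction p)
  case 0
  have "insertion_cycle 0 = id"
    by (auto simp: fun_eq_iff insertion_cycle_def)
  then show ?case by simp
next
  case (Suc p)
  have "permutation (insertion_cycle p)"
    using insertion_cycle_permutes permutation_permutes by blast
  then show ?case
    using Suc by (simp add: insertion_cycle_Suc sign_compose sign_swap_id permutation_swap_id del: o_apply comp_apply)
qed

lemma permute_list_insertion_cycle:
  assumes "p \<le> length xs"
  shows "permute_list (insertion_cycle p) (x # xs) = take p xs @ x # drop p xs"
  using assms
  by (auto simp: list_eq_iff_nth_eq permute_list_def insertion_cycle_def nth_append nth_Cons'
      simp del: upt_Suc)

section \<open>The wedge product as an alternating form\<close>

lemma wedge_form_eq:
  assumes "alt_form p \<phi>" "alt_form q \<psi>" "length xs = p + q"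
  shows "wedge_form \<phi> \<psi> xs = (\<Sum>\<sigma> | \<sigma> permutes {..<p + q}. of_int (sign \<sigma>) *
    (\<phi> (take p (permute_list \<sigma> xs)) * \<psi> (drop p (permute_list \<sigma> xs)))) / (fact p * fact q)"
proof -
  have z: "\<phi> (take r (permute_list \<sigma> xs)) = 0" if "r \<le> length xs" "r \<noteq> p" for r \<sigma>
    using assms that unfolding alt_form_def by simp
  have "wedge_form \<phi> \<psi> xs = (\<Sum>r\<in>{p}. (\<Sum>\<sigma> | \<sigma> permutes {..<length xs}.
        of_int (sign \<sigma>) * \<phi> (take r (permute_list \<sigma> xs)) * \<psi> (drop r (permute_list \<sigma> xs)))
        / (fact r * fact (length xs - r)))"
    unfolding wedge_form_def
    by (rule sum.mono_neutral_right) (use assms z in auto)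
  then show ?thesis
    using assms by (simp add: mult.assoc)
qed

lemma wedge_form_wrong_length:
  assumes "alt_form p \<phi>" "alt_form q \<psi>" "length xs \<noteq> p + q"
  shows "wedge_form \<phi> \<psi> xs = 0"
proof -
  \<comment> \<open>A split at \<open>p\<close> leaves \<psi> a block of length other than
    \<open>q\<close>, and any other split gives \<phi> a block of the wrong length.\<close>
  have "(\<Sum>\<sigma>\<in>S. of_int (sign \<sigma>) *
      (\<phi> (take r (permute_list \<sigma> xs)) * \<psi> (drop r (permute_list \<sigma> xs)))) = 0"
    if "r \<le> length xs" for r S
    using assms that unfolding alt_form_def by (cases "r = p") auto
  then show ?thesis
    unfolding wedge_form_def mult.assoc by (intro sum.neutral ballI) (simp add: atMost_def)
qed

text \<open>A sign-reversing involution: composing \<sigma> with the transposition of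
  \<open>i\<close> and \<open>j\<close> flips its sign but leaves the permuted list unchanged,
  because the two entries agree. Hence every inner sum equals its own negative.\<close>

lemma wedge_form_repeated:
  assumes "i < length xs" "j < length xs" "i \<noteq> j" "xs ! i = xs ! j"
  shows "wedge_form \<phi> \<psi> xs = 0"
proof -
  let ?t = "Transposition.transpose i j" and ?S = "{\<sigma>. \<sigma> permutes {..<length xs}}"
  let ?G = "\<lambda>r ys. \<phi> (take r ys) * \<psi> (drop r ys) :: real"
  have t: "?t permutes {..<length xs}"
    using assms by (intro permutes_swap_id) auto
  have xt: "xs ! ?t k = xs ! k" for k
    using assms by (auto simp: Transposition.transpose_def)
  have "(\<Sum>\<sigma>\<in>?S. of_int (sign \<sigma>) * ?G r (permute_list \<sigma> xs)) = 0" (is "?s = 0") for r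
  proof -
    have "?s = (\<Sum>\<sigma>\<in>?S. of_int (sign (?t \<circ> \<sigma>)) * ?G r (permute_list (?t \<circ> \<sigma>) xs))"
      by (rule sum.reindex_bij_witness[where i = "\<lambda>\<sigma>. ?t \<circ> \<sigma>" and j = "\<lambda>\<sigma>. ?t \<circ> \<sigma>"])
        (simp_all add: permutes_compose[OF _ t] flip: o_assoc, simp_all add: o_assoc)
    also have "\<dots> = (\<Sum>\<sigma>\<in>?S. - (of_int (sign \<sigma>) * ?G r (permute_list \<sigma> xs)))"
    proof (rule sum.cong[OF refl])
      fix \<sigma> assume "\<sigma> \<in> ?S"
      then have "permutation \<sigma>"
        using permutation_permutes by blast
      then show "of_int (sign (?t \<circ> \<sigma>)) * ?G r (permute_list (?t \<circ> \<sigma>) xs) =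
        - (of_int (sign \<sigma>) * ?G r (permute_list \<sigma> xs))"
        using assms by (simp add: sign_compose sign_swap_id permutation_swap_id permute_list_def xt)
    qed
    finally show ?thesis
      by (simp add: sum_negf)
  qed
  then show ?thesis
    unfolding wedge_form_def by (simp add: mult.assoc)
qed

lemma permute_list_update:
  assumes "\<sigma> permutes {..<length xs}" "k < length xs"
  shows "permute_list \<sigma> (xs[\<sigma> k := u]) = (permute_list \<sigma> xs)[k := u]"
proof (rule nth_equalityI)
  fix i assume "i < length (permute_list \<sigma> (xs[\<sigma> k := u]))"
  then have i: "i < length xs"
    by simp
  moreover have "\<sigma> i < length xs" "\<sigma> k = \<sigma> i \<longleftrightarrow> k = i"
    using i permutes_in_image[OF assms(1), of i] permutes_inj[OF assms(1)] by (auto simp: inj_eq)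
  ultimately show "permute_list \<sigma> (xs[\<sigma> k := u]) ! i = (permute_list \<sigma> xs)[k := u] ! i"
    using assms by (simp add: permute_list_def nth_list_update)
qed simp

text \<open>In each summand the entry at \<open>i\<close> moves to the place \<open>k\<close> with
  \<open>i = \<sigma> k\<close>, hence into exactly one of the two blocks; that factor is linear in
  it and the other one is constant.\<close>

lemma linear_wedge_form:
  assumes "alt_form p \<phi>" "alt_form q \<psi>" "length xs = p + q" "i < p + q"
  shows "linear (\<lambda>u. wedge_form \<phi> \<psi> (xs[i := u]))"
proof -
  have *: "linear (\<lambda>u. \<phi> (take p (permute_list \<sigma> (xs[i := u]))) *
      \<psi> (drop p (permute_list \<sigma> (xs[i := u]))))"
    if \<sigma>: "\<sigma> permutes {..<p + q}" for \<sigma>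
  proof -
    obtain k where k: "k < p + q" "i = \<sigma> k"
      using \<sigma> assms(4) permutes_image[OF \<sigma>] by (metis imageE lessThan_iff)
    let ?ys = "permute_list \<sigma> xs"
    have e: "permute_list \<sigma> (xs[i := u]) = ?ys[k := u]" for u
      using permute_list_update[of \<sigma> xs k u] \<sigma> assms k by simp
    show ?thesis
    proof (cases "k < p")
      case True
      have "linear (\<lambda>u. \<phi> ((take p ?ys)[k := u]))"
        using True assms by (intro alt_form_linear) auto
      then show ?thesis
        using True unfolding e by (auto simp: take_update_swap linear_iff algebra_simps)
    next
      case False
      have "linear (\<lambda>u. \<psi> ((drop p ?ys)[k - p := u]))"
        using False assms k by (intro alt_form_linear) auto
      then show ?thesis
        using False unfolding e by (auto simp: drop_update_swap linear_iff algebra_simps)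
    qed
  qed
  have "linear (\<lambda>u. (1 / (fact p * fact q)) *\<^sub>R (\<Sum>\<sigma> | \<sigma> permutes {..<p + q}. (of_int (sign \<sigma>) :: real) *\<^sub>R
    (\<phi> (take p (permute_list \<sigma> (xs[i := u]))) * \<psi> (drop p (permute_list \<sigma> (xs[i := u]))))))"
    by (intro linear_compose_scale_right linear_compose_sum ballI *) auto
  then show ?thesis
    using assms by (simp add: wedge_form_eq)
qed

lemma alt_form_wedge_form:
  assumes "alt_form p \<phi>" "alt_form q \<psi>"
  shows "alt_form (p + q) (wedge_form \<phi> \<psi>)"
  unfolding alt_form_def
proof (intro conjI allI impI; (elim conjE)?)
  fix xs :: "'a list" and i j
  assume "length xs = p + q" "i < j" "j < p + q" "xs ! i = xs ! j"
  then show "wedge_form \<phi> \<psi> xs = 0"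
    by (intro wedge_form_repeated[of i xs j]) auto
qed (simp_all add: wedge_form_wrong_length[OF assms] linear_wedge_form[OF assms])

lemma alt_form_wedge_power:
  assumes "alt_form k \<phi>"
  shows "alt_form (m * k) (wedge_power \<phi> m)"
proof (induction m)
  case 0
  show ?case by (auto simp: alt_form_def)
next
  case (Suc m)
  then show ?case
    using alt_form_wedge_form[OF assms Suc] by simp
qed

lemma wedge_form_zero [simp]: "wedge_form (\<lambda>_. 0) \<psi> = (\<lambda>_. 0)" "wedge_form \<phi> (\<lambda>_. 0) = (\<lambda>_. 0)"
  by (auto simp: wedge_form_def fun_eq_iff)

lemma wedge_form_scale_left: "wedge_form (\<lambda>xs. c * \<phi> xs) \<psi> = (\<lambda>xs. c * wedge_form \<phi> \<psi> xs)"
  by (auto simp: wedge_form_def fun_eq_iff sum_distrib_left mult_ac)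

lemma wedge_form_scale_right: "wedge_form \<phi> (\<lambda>xs. c * \<psi> xs) = (\<lambda>xs. c * wedge_form \<phi> \<psi> xs)"
  by (auto simp: wedge_form_def fun_eq_iff sum_distrib_left mult_ac)

lemma wedge_form_add_right:
  "wedge_form \<phi> (\<lambda>xs. \<psi> xs + \<psi>' xs) = (\<lambda>xs. wedge_form \<phi> \<psi> xs + wedge_form \<phi> \<psi>' xs)"
  by (auto simp: wedge_form_def fun_eq_iff distrib_left add_divide_distrib sum.distrib)

lemma alt_form_interior_form:
  assumes "alt_form (Suc k) \<phi>"
  shows "alt_form k (interior_form x \<phi>)"
proof -
  have "linear (\<lambda>u. \<phi> (x # xs[i := u]))" if "length xs = k" "i < k" for xs i
    using alt_form_linear[OF assms, of "x # xs" "Suc i"] that by simp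
  moreover have "\<phi> (x # xs) = 0" if "length xs = k" "i < j" "j < k" "xs ! i = xs ! j" for xs i j
    using assms that unfolding alt_form_def
    by (metis Suc_less_eq length_Cons nth_Cons_Suc)
  moreover have "\<phi> (x # xs) = 0" if "length xs \<noteq> k" for xs
    using assms that unfolding alt_form_def by simp
  ultimately show ?thesis
    unfolding alt_form_def interior_form_def by blast
qed

text \<open>The degree 0 counterpart of \<open>alt_form_interior_form\<close>: a 0-form vanishes on
  every nonempty list.\<close>

lemma interior_form_alt_0:
  assumes "alt_form 0 \<phi>"
  shows "interior_form x \<phi> = (\<lambda>_. 0)"
  using assms by (auto simp: alt_form_def interior_form_def)

section \<open>The interior product\<close>

text \<open>The transposition stays within the first block, so only \<phi> sees it and contributes
  its sign.\<close>

lemma alt_form_product_transpose_left: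
  assumes "alt_form p \<phi>" "k < p" "p \<le> length L"
  shows "\<phi> (take p (permute_list (Transposition.transpose 0 k) L)) *
      \<psi> (drop p (permute_list (Transposition.transpose 0 k) L)) =
    of_int (sign (Transposition.transpose 0 k)) * (\<phi> (take p L) * \<psi> (drop p L) :: real)"
proof -
  let ?t = "Transposition.transpose 0 k"
  have t: "?t permutes {..<p}"
    using assms by (intro permutes_swap_id) auto
  have p: "permute_list ?t L = L[0 := L ! k, k := L ! 0]"
    using assms by (intro permute_list_transpose) auto
  have p': "permute_list ?t (take p L) = (take p L)[0 := take p L ! k, k := take p L ! 0]"
    using assms by (intro permute_list_transpose) auto
  have "take p (permute_list ?t L) = permute_list ?t (take p L)"
    using assms by (simp add: p p' take_update_swap)
  moreover have "drop p (permute_list ?t L) = drop p L"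
    using assms by (simp add: p)
  ultimately show ?thesis
    using alt_form_permute_list[OF assms(1) _ t, of "take p L"] assms by simp
qed

text \<open>The transposition stays within the second block, where place \<open>k\<close> of the
  whole list has index \<open>k - p\<close>; only \<psi> sees it.\<close>

lemma alt_form_product_transpose_right:
  assumes "alt_form q \<psi>" "p \<le> k" "k < p + q" "length L = p + q"
  shows "\<phi> (take p (permute_list (Transposition.transpose p k) L)) *
      \<psi> (drop p (permute_list (Transposition.transpose p k) L)) =
    of_int (sign (Transposition.transpose p k)) * (\<phi> (take p L) * \<psi> (drop p L) :: real)"
proof -
  let ?t = "Transposition.transpose p k" and ?t' = "Transposition.transpose 0 (k - p)"
  have t: "?t' permutes {..<q}"
    using assms by (intro permutes_swap_id) auto
  have p: "permute_list ?t L = L[p := L ! k, k := L ! p]"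
    using assms by (intro permute_list_transpose) auto
  have p': "permute_list ?t' (drop p L) = (drop p L)[0 := drop p L ! (k - p), k - p := drop p L ! 0]"
    using assms by (intro permute_list_transpose) auto
  have "drop p (permute_list ?t L) = permute_list ?t' (drop p L)"
    using assms by (simp add: p p' drop_update_swap)
  moreover have "take p (permute_list ?t L) = take p L"
    using assms by (simp add: p)
  moreover have "sign ?t' = sign ?t"
    using assms by (simp add: sign_swap_id)
  ultimately show ?thesis
    using alt_form_permute_list[OF assms(1) _ t, of "drop p L"] assms by simp
qed

text \<open>Sorts the permutations by the place at which \<open>x\<close> arrives. The
  \<open>p\<close> places in the first block contribute alike, and so do the \<open>q\<close> places
  in the second; the factors \<open>p\<close> and \<open>q\<close> reduce the factorials to those of
  the contracted forms.\<close>

lemma interior_form_wedge_form: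
  fixes x :: "'a::real_vector"
  assumes \<phi>: "alt_form p \<phi>" and \<psi>: "alt_form q \<psi>"
  shows "interior_form x (wedge_form \<phi> \<psi>) = (\<lambda>xs. wedge_form (interior_form x \<phi>) \<psi> xs +
    (- 1) ^ p * wedge_form \<phi> (interior_form x \<psi>) xs)"
proof
  fix xs :: "'a list"
  let ?N = "length xs"
  show "interior_form x (wedge_form \<phi> \<psi>) xs = wedge_form (interior_form x \<phi>) \<psi> xs +
    (- 1) ^ p * wedge_form \<phi> (interior_form x \<psi>) xs"
  proof (cases "Suc ?N = p + q")
    case False
    have "wedge_form (interior_form x \<phi>) \<psi> xs = 0"
    proof (cases p)
      case 0
      then show ?thesis using interior_form_alt_0[of \<phi> x] \<phi> by simp
    next
      case (Suc p')
      then show ?thesis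
        using False \<phi> \<psi> by (intro wedge_form_wrong_length[of p' _ q] alt_form_interior_form) auto
    qed
    moreover have "wedge_form \<phi> (interior_form x \<psi>) xs = 0"
    proof (cases q)
      case 0
      then show ?thesis using interior_form_alt_0[of \<psi> x] \<psi> by simp
    next
      case (Suc q')
      then show ?thesis
        using False \<phi> \<psi> by (intro wedge_form_wrong_length[of p _ q'] alt_form_interior_form) auto
    qed
    ultimately show ?thesis
      using False wedge_form_wrong_length[OF \<phi> \<psi>, of "x # xs"] by (simp add: interior_form_def)
  next
    case True
    let ?M = "map_permutation {..<?N} Suc"
    let ?G = "\<lambda>L. \<phi> (take p L) * \<psi> (drop p L)"
    \<comment> \<open>If \<open>x\<close> lands in an argument of \<open>\<phi>\<close>, swap it to the front of these; if it lands in an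
      argument of \<open>\<psi>\<close>, swap it to the front of those and let the cycle account for \<open>(- 1) ^ p\<close>.\<close>
    define \<rho> where "\<rho> k = (if k < p then Transposition.transpose 0 k
      else insertion_cycle p \<circ> Transposition.transpose p k)" for k
    \<comment> \<open>For p = 0 the truncated \<open>p - 1\<close> is harmless: the sum of these
      terms then enters with the factor 0.\<close>
    define a where "a \<tau> = of_int (sign \<tau>) * (interior_form x \<phi> (take (p - 1) (permute_list \<tau> xs)) *
      \<psi> (drop (p - 1) (permute_list \<tau> xs)))" for \<tau>
    define b where "b \<tau> = of_int (sign \<tau>) * (\<phi> (take p (permute_list \<tau> xs)) *
      interior_form x \<psi> (drop p (permute_list \<tau> xs)))" for \<tau>
    have \<rho>: "\<rho> k permutes {..<Suc ?N}" "\<rho> k k = 0" if "k \<le> ?N" for k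
    proof -
      show "\<rho> k permutes {..<Suc ?N}"
      proof (cases "k < p")
        case True
        then show ?thesis
          using that by (simp add: \<rho>_def permutes_swap_id)
      next
        case False
        have "insertion_cycle p permutes {..<Suc ?N}"
          using insertion_cycle_permutes[of p] by (rule permutes_subset) (use that False in auto)
        moreover have "Transposition.transpose p k permutes {..<Suc ?N}"
          by (rule permutes_swap_id) (use that False in auto)
        ultimately show ?thesis
          using False by (simp only: \<rho>_def if_False permutes_compose)
      qed
      show "\<rho> k k = 0"
        by (simp add: \<rho>_def insertion_cycle_def)
    qed
    have summand: "of_int (sign (?M \<tau> \<circ> \<rho> k)) * ?G (permute_list (?M \<tau> \<circ> \<rho> k) (x # xs)) =
      (if k < p then a \<tau> else (- 1) ^ p * b \<tau>)" if "k \<le> ?N" and \<tau>: "\<tau> permutes {..<?N}" for k \<tau>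
    proof -
      let ?z = "permute_list \<tau> xs"
      have "?M \<tau> permutes Suc ` {..<?N}"
        using \<tau> by (intro map_permutation_permutes) (auto simp: bij_betw_def)
      then have "permutation (?M \<tau>)"
        using permutation_permutes by blast
      moreover have "permutation (\<rho> k)"
        using \<rho>(1)[OF that(1)] permutation_permutes by blast
      ultimately have s: "sign (?M \<tau> \<circ> \<rho> k) = sign \<tau> * sign (\<rho> k)"
        using \<tau> by (simp only: sign_compose) (simp add: sign_map_permutation)
      have z: "permute_list (?M \<tau> \<circ> \<rho> k) (x # xs) = permute_list (\<rho> k) (x # ?z)"
        using \<rho>(1)[OF that(1)] by (subst permute_list_compose)
          (simp_all add: permute_list_map_permutation_Suc[OF \<tau>] lessThan_Suc)
      show ?thesis
      proof (cases "k < p")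
        case True
        have "?G (permute_list (\<rho> k) (x # ?z)) = of_int (sign (\<rho> k)) * ?G (x # ?z)"
          using True that \<open>Suc ?N = p + q\<close> \<phi>
          by (simp only: \<rho>_def if_True) (rule alt_form_product_transpose_left, auto)
        moreover have "?G (x # ?z) = interior_form x \<phi> (take (p - 1) ?z) * \<psi> (drop (p - 1) ?z)"
          using True by (cases p) (auto simp: interior_form_def)
        \<comment> \<open>The sign of \<open>\<rho> k\<close> occurs in the sign of the composition
          and again when the arguments of \<phi> are reordered, so it cancels.\<close>
        moreover have "(of_int (sign (\<rho> k)) :: real) * of_int (sign (\<rho> k)) = 1"
          by (metis of_int_1 of_int_mult sign_idempotent)
        ultimately show ?thesis
          unfolding s z a_def using True by (simp add: mult_ac)
      next
        case False
        let ?t = "Transposition.transpose p k"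
        have k: "p \<le> k" "k < p + q" "p \<le> ?N"
          using False that \<open>Suc ?N = p + q\<close> by auto
        have t: "?t permutes {..<length (x # ?z)}"
          by (rule permutes_swap_id) (use k that in auto)
        have "permute_list (\<rho> k) (x # ?z) = permute_list ?t (take p ?z @ x # drop p ?z)"
          using False k unfolding \<rho>_def
          by (simp only: if_False permute_list_compose[OF t]) (simp add: permute_list_insertion_cycle)
        then have "?G (permute_list (\<rho> k) (x # ?z)) =
            of_int (sign ?t) * ?G (take p ?z @ x # drop p ?z)"
          using alt_form_product_transpose_right[OF \<psi> k(1,2), of "take p ?z @ x # drop p ?z"]
            \<open>Suc ?N = p + q\<close> k by simp
        moreover have "?G (take p ?z @ x # drop p ?z) =
            \<phi> (take p ?z) * interior_form x \<psi> (drop p ?z)"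
          using k by (simp add: interior_form_def)
        moreover have "(of_int (sign ?t) :: real) * of_int (sign ?t) = 1"
          by (metis of_int_1 of_int_mult sign_idempotent)
        moreover have "permutation (insertion_cycle p)"
          using insertion_cycle_permutes permutation_permutes by blast
        then have "sign (\<rho> k) = (- 1) ^ p * sign ?t"
          using False by (simp only: \<rho>_def if_False sign_compose permutation_swap_id sign_insertion_cycle)
        ultimately show ?thesis
          unfolding s z b_def using False by (simp add: mult_ac)
      qed
    qed
    define A where "A = (\<Sum>\<tau> | \<tau> permutes {..<?N}. a \<tau>)"
    define B where "B = (\<Sum>\<tau> | \<tau> permutes {..<?N}. b \<tau>)"
    have "interior_form x (wedge_form \<phi> \<psi>) xs = wedge_form \<phi> \<psi> (x # xs)"
      by (simp add: interior_form_def)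
    also have "\<dots> = (\<Sum>\<sigma> | \<sigma> permutes {..<Suc ?N}. of_int (sign \<sigma>) * ?G (permute_list \<sigma> (x # xs)))
        / (fact p * fact q)"
      unfolding True by (rule wedge_form_eq[OF \<phi> \<psi>]) (use True in simp)
    also have "\<dots> = (\<Sum>k\<le>?N. \<Sum>\<tau> | \<tau> permutes {..<?N}.
        of_int (sign (?M \<tau> \<circ> \<rho> k)) * ?G (permute_list (?M \<tau> \<circ> \<rho> k) (x # xs))) / (fact p * fact q)"
      by (subst sum_permutes_lessThan_Suc[of ?N \<rho>]) (use \<rho> in auto)
    also have "\<dots> = (\<Sum>k\<le>?N. \<Sum>\<tau> | \<tau> permutes {..<?N}. if k < p then a \<tau> else (- 1) ^ p * b \<tau>)
        / (fact p * fact q)"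
      by (intro arg_cong2[where f = "(/)"] sum.cong refl summand) auto
    also have "\<dots> = (\<Sum>k\<in>{..<p} \<union> {p..<p + q}. if k < p then A else (- 1) ^ p * B) / (fact p * fact q)"
    proof -
      have e: "{..?N} = {..<p} \<union> {p..<p + q}"
        using True by auto
      show ?thesis
        unfolding e by (intro arg_cong2[where f = "(/)"] sum.cong refl) (simp add: A_def B_def sum_distrib_left)
    qed
    also have "\<dots> = real p * A / (fact p * fact q) + (- 1) ^ p * (real q * B / (fact p * fact q))"
      by (subst sum.union_disjoint) (auto simp: add_divide_distrib)
    also have "real p * A / (fact p * fact q) = wedge_form (interior_form x \<phi>) \<psi> xs"
    proof (cases p)
      case 0
      then show ?thesis using interior_form_alt_0[of \<phi> x] \<phi> by simp
    next
      case (Suc p')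
      then have "wedge_form (interior_form x \<phi>) \<psi> xs = A / (fact p' * fact q)"
        unfolding A_def a_def using wedge_form_eq[OF alt_form_interior_form \<psi>, of p' \<phi> xs x] \<phi> True by simp
      then show ?thesis
        using Suc by (simp add: divide_simps)
    qed
    also have "real q * B / (fact p * fact q) = wedge_form \<phi> (interior_form x \<psi>) xs"
    proof (cases q)
      case 0
      then show ?thesis using interior_form_alt_0[of \<psi> x] \<psi> by simp
    next
      case (Suc q')
      then have "wedge_form \<phi> (interior_form x \<psi>) xs = B / (fact p * fact q')"
        unfolding B_def b_def using wedge_form_eq[OF \<phi> alt_form_interior_form, of q' \<psi> xs x] \<psi> True by simp
      then show ?thesis
        using Suc by (simp add: divide_simps)
    qed
    finally show ?thesis .
  qed
qed

section \<open>Graded commutation and contraction of powers\<close>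

lemma wedge_form_Nil: "wedge_form \<phi> \<psi> [] = \<phi> [] * \<psi> []"
  by (simp add: wedge_form_def)

text \<open>Contraction with the head of the argument list lowers one degree at a time, so induction
  on the list compares both sides term by term. The third factor is there so that a form can be
  moved past the first factor of a \<open>wedge_power\<close>.\<close>

lemma wedge_form_left_commute:
  assumes "alt_form p \<phi>" "alt_form q \<xi>" "alt_form r \<psi>"
  shows "wedge_form \<phi> (wedge_form \<xi> \<psi>) xs = (- 1) ^ (p * q) * wedge_form \<xi> (wedge_form \<phi> \<psi>) xs"
  using assms
proof (induction xs arbitrary: p q r \<phi> \<xi> \<psi>)
  case Nil
  show ?case
  proof (cases "p * q = 0")
    case True
    then show ?thesis by (auto simp: wedge_form_Nil)
  next
    case False
    then have "\<phi> [] = 0"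
      using Nil unfolding alt_form_def by auto
    then show ?thesis by (simp add: wedge_form_Nil)
  qed
next
  case (Cons x xs)
  note forms = Cons.prems
  have \<phi>: "wedge_form (interior_form x \<phi>) (wedge_form \<xi> \<psi>) xs =
      (- 1) ^ (p * q) * (- 1) ^ q * wedge_form \<xi> (wedge_form (interior_form x \<phi>) \<psi>) xs"
  proof (cases p)
    case 0
    then show ?thesis using interior_form_alt_0[of \<phi> x] forms by simp
  next
    case (Suc p')
    \<comment> \<open>The exponents p q + q and (p - 1) q differ by the even number 2 q.\<close>
    have "(- 1 :: real) ^ (p * q) * (- 1) ^ q = (- 1) ^ (p' * q)"
      using Suc by (simp add: power_add flip: power_mult_distrib)
    then show ?thesis
      using Cons.IH[of p' "interior_form x \<phi>" q \<xi> r \<psi>] alt_form_interior_form[of p' \<phi> x] forms Suc by simp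
  qed
  have \<xi>: "(- 1) ^ p * wedge_form \<phi> (wedge_form (interior_form x \<xi>) \<psi>) xs =
      (- 1) ^ (p * q) * wedge_form (interior_form x \<xi>) (wedge_form \<phi> \<psi>) xs"
  proof (cases q)
    case 0
    then show ?thesis using interior_form_alt_0[of \<xi> x] forms by simp
  next
    case (Suc q')
    then show ?thesis
      using Cons.IH[of p \<phi> q' "interior_form x \<xi>" r \<psi>] alt_form_interior_form[of q' \<xi> x] forms Suc
      by (simp add: power_add)
  qed
  have \<psi>: "wedge_form \<phi> (wedge_form \<xi> (interior_form x \<psi>)) xs =
      (- 1) ^ (p * q) * wedge_form \<xi> (wedge_form \<phi> (interior_form x \<psi>)) xs"
  proof (cases r)
    case 0
    then show ?thesis using interior_form_alt_0[of \<psi> x] forms by simp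
  next
    case (Suc r')
    then show ?thesis
      using Cons.IH[of p \<phi> q \<xi> r' "interior_form x \<psi>"] alt_form_interior_form[of r' \<psi> x] forms Suc by simp
  qed
  have i: "wedge_form \<phi>' \<psi>' (x # xs) = wedge_form (interior_form x \<phi>') \<psi>' xs +
      (- 1) ^ k * wedge_form \<phi>' (interior_form x \<psi>') xs" if "alt_form k \<phi>'" "alt_form l \<psi>'" for k l \<phi>' \<psi>'
    using fun_cong[OF interior_form_wedge_form[OF that], of x xs] by (simp add: interior_form_def)
  show ?case
    unfolding i[OF forms(1) alt_form_wedge_form[OF forms(2,3)]]
      i[OF forms(2) alt_form_wedge_form[OF forms(1,3)]]
      interior_form_wedge_form[OF forms(1,3)] interior_form_wedge_form[OF forms(2,3)]
      wedge_form_add_right wedge_form_scale_right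
    using \<phi> \<xi> \<psi> by (simp add: algebra_simps)
qed

text \<open>As \<omega> has even degree, the antiderivation rule brings no sign and the contracted
  1-form commutes with \<omega>; so every factor of the power contributes the same term.\<close>

lemma interior_form_wedge_power:
  assumes "alt_form 2 \<omega>"
  shows "interior_form x (wedge_power \<omega> (Suc m)) =
    (\<lambda>xs. real (Suc m) * wedge_form (interior_form x \<omega>) (wedge_power \<omega> m) xs)"
proof (induction m)
  case 0
  have "alt_form 0 (wedge_power \<omega> 0)"
    using alt_form_wedge_power[OF assms, of 0] by simp
  then have "interior_form x (wedge_power \<omega> 0) = (\<lambda>_. 0)"
    by (rule interior_form_alt_0)
  then show ?case
    using interior_form_wedge_form[OF assms \<open>alt_form 0 (wedge_power \<omega> 0)\<close>, of x] by simp
next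
  case (Suc m)
  have i: "alt_form 1 (interior_form x \<omega>)"
    using assms by (intro alt_form_interior_form) (simp add: numeral_2_eq_2)
  have "interior_form x (wedge_power \<omega> (Suc (Suc m))) =
      (\<lambda>xs. wedge_form (interior_form x \<omega>) (wedge_power \<omega> (Suc m)) xs +
        real (Suc m) * wedge_form \<omega> (wedge_form (interior_form x \<omega>) (wedge_power \<omega> m)) xs)"
    using interior_form_wedge_form[OF assms alt_form_wedge_power[OF assms, of "Suc m"], of x]
    unfolding Suc wedge_form_scale_right by simp
  then show ?case
    using wedge_form_left_commute[OF assms i alt_form_wedge_power[OF assms, of m]]
    by (simp add: fun_eq_iff algebra_simps)
qed

section \<open>Nondegeneracy and traces\<close>

text \<open>A vector outside the span of \<open>C\<close> would extend \<open>C\<close> to an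
  independent set larger than the spanning set \<open>B\<close>.\<close>

lemma independent_card_ge_spans:
  fixes B C :: "'a::real_vector set"
  assumes "finite B" "span B = UNIV" "independent C" "card B \<le> card C"
  shows "span C = UNIV"
proof (rule ccontr)
  assume "span C \<noteq> UNIV"
  then obtain x where x: "x \<notin> span C"
    by blast
  have fin: "finite C"
    using independent_span_bound[OF assms(1,3)] assms(2) by simp
  have "card (insert x C) \<le> card B"
    using independent_span_bound[OF assms(1) independent_insertI[OF x assms(3)]] assms(2) by simp
  moreover have "x \<notin> C"
    using x span_base by blast
  ultimately show False
    using fin assms(4) by simp
qed

text \<open>A finite spanning set bounds the size of independent sets, so a maximal independent set
  is a finite basis.\<close>

lemma finite_basis_exists:
  fixes C :: "'a::real_vector set"
  assumes "finite C" "span C = UNIV"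
  obtains B :: "'a set" where "finite B" "independent B" "span B = UNIV" "card B = dim (UNIV :: 'a set)"
proof -
  obtain B :: "'a set" where B: "independent B" "span B = UNIV"
    using maximal_independent_subset[of "UNIV :: 'a set"] by (metis top.extremum_uniqueI)
  moreover have "finite B"
    using independent_span_bound[OF assms(1) B(1)] assms(2) by simp
  moreover have "card B = dim (UNIV :: 'a set)"
    using dim_eq_card[of B UNIV] B by simp
  ultimately show thesis
    using that by blast
qed

text \<open>Cramer's rule: after expansion in slot \<open>i\<close>, every term with j \<noteq> i
  repeats an argument and drops out.\<close>

lemma alt_form_update_lincomb:
  assumes "alt_form k \<phi>" "length xs = k" "i < k"
  shows "\<phi> (xs[i := \<Sum>j<k. c j *\<^sub>R xs ! j]) = c i * \<phi> xs"
proof -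
  have lin: "linear (\<lambda>x. \<phi> (xs[i := x]))"
    using assms by (rule alt_form_linear)
  have *: "\<And>ys i j. length ys = k \<Longrightarrow> i < j \<Longrightarrow> j < k \<Longrightarrow> ys ! i = ys ! j \<Longrightarrow> \<phi> ys = 0"
    using assms(1) unfolding alt_form_def by blast
  have z: "\<phi> (xs[i := xs ! j]) = (if j = i then \<phi> xs else 0)" if "j < k" for j
    using *[of "xs[i := xs ! j]" i j] *[of "xs[i := xs ! j]" j i] assms that
    by (cases i j rule: linorder_cases) auto
  have "\<phi> (xs[i := \<Sum>j<k. c j *\<^sub>R xs ! j]) = (\<Sum>j<k. c j * \<phi> (xs[i := xs ! j]))"
    by (simp add: linear_sum[OF lin] linear_scale[OF lin])
  also have "\<dots> = (\<Sum>j<k. if j = i then c i * \<phi> xs else 0)"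
    by (intro sum.cong refl) (auto simp: z)
  also have "\<dots> = c i * \<phi> xs"
    using assms by simp
  finally show ?thesis .
qed

text \<open>By Cramer's rule a nonzero value makes the arguments independent; being at least as many
  as the elements of \<open>B\<close>, they span.\<close>

lemma alt_form_nonzero_spans:
  fixes \<phi> :: "'a::real_vector list \<Rightarrow> real" and B :: "'a set"
  assumes "alt_form k \<phi>" "\<phi> xs \<noteq> 0" "finite B" "span B = UNIV" "card B \<le> k"
  obtains c where "x = (\<Sum>j<k. c j *\<^sub>R xs ! j)"
proof -
  have len: "length xs = k"
    using assms unfolding alt_form_def by blast
  have *: "\<And>i j. i < j \<Longrightarrow> j < k \<Longrightarrow> xs ! i = xs ! j \<Longrightarrow> \<phi> xs = 0"
    using assms(1) len unfolding alt_form_def by blast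
  have dist: "distinct xs"
    unfolding distinct_conv_nth using * assms(2) len by (metis linorder_neqE_nat)
  have sum_eq: "(\<Sum>v\<in>set xs. u v *\<^sub>R v) = (\<Sum>j<k. u (xs ! j) *\<^sub>R xs ! j)" for u
    using sum.reindex_bij_betw[OF bij_betw_nth[OF dist refl refl], of "\<lambda>v. u v *\<^sub>R v"] len by simp
  have "independent (set xs)"
  proof (rule independent_if_scalars_zero)
    fix u v
    assume u: "(\<Sum>v\<in>set xs. u v *\<^sub>R v) = 0" and "v \<in> set xs"
    then obtain i where i: "i < k" "v = xs ! i"
      using len by (metis in_set_conv_nth)
    have "u (xs ! i) * \<phi> xs = \<phi> (xs[i := 0])"
      using alt_form_update_lincomb[OF assms(1) len i(1), of "\<lambda>j. u (xs ! j)"] u sum_eq by simp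
    also have "\<dots> = 0"
      by (rule linear_0[OF alt_form_linear[OF assms(1) len i(1)]])
    finally show "u v = 0"
      using assms(2) i by simp
  qed simp
  then have "span (set xs) = UNIV"
    by (rule independent_card_ge_spans[OF assms(3,4)]) (simp add: distinct_card[OF dist] len assms(5))
  then have "x \<in> range (\<lambda>u. \<Sum>v\<in>set xs. u v *\<^sub>R v)"
    by (metis List.finite_set UNIV_I span_finite)
  then show thesis
    using that sum_eq by auto
qed

text \<open>Every permuted list still has \<open>x\<close> in one of its two blocks, so one factor
  of each summand vanishes.\<close>

lemma wedge_form_eq_0_if_mem:
  assumes "\<And>ys. x \<in> set ys \<Longrightarrow> \<phi> ys = 0" "\<And>ys. x \<in> set ys \<Longrightarrow> \<psi> ys = 0" "x \<in> set xs"
  shows "wedge_form \<phi> \<psi> xs = 0"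
proof -
  have "\<phi> (take r (permute_list \<sigma> xs)) = 0 \<or> \<psi> (drop r (permute_list \<sigma> xs)) = 0"
    if "\<sigma> permutes {..<length xs}" for r \<sigma>
  proof -
    have "x \<in> set (take r (permute_list \<sigma> xs) @ drop r (permute_list \<sigma> xs))"
      using assms(3) that by simp
    then show ?thesis
      using assms(1,2) by (auto simp del: append_take_drop_id)
  qed
  then show ?thesis
    unfolding wedge_form_def by (intro sum.neutral ballI) (auto intro!: sum.neutral)
qed

lemma wedge_power_eq_0_if_mem:
  assumes "\<And>ys. x \<in> set ys \<Longrightarrow> \<phi> ys = 0" "x \<in> set xs"
  shows "wedge_power \<phi> m xs = 0"
  using assms(2)
proof (induction m arbitrary: xs)
  case (Suc m)
  then show ?case
    using assms(1) by (auto intro: wedge_form_eq_0_if_mem)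
qed auto

lemma bilinear_self_zero_swap:
  fixes f :: "'a::real_vector \<Rightarrow> 'a \<Rightarrow> real"
  assumes "bilinear f" "\<And>x. f x x = 0"
  shows "f x y = - f y x"
proof -
  have "f (x + y) (x + y) = f x x + f x y + (f y x + f y y)"
    by (simp add: bilinear_ladd[OF assms(1)] bilinear_radd[OF assms(1)])
  then show ?thesis
    using assms(2) by simp
qed

lemma alt_form_1_linear: "alt_form 1 \<phi> \<Longrightarrow> linear (\<lambda>x. \<phi> [x])"
  using alt_form_linear[of 1 \<phi> "[0]" 0] by simp

lemma alt_form_2_bilinear:
  assumes "alt_form 2 \<omega>"
  shows "bilinear (\<lambda>x y. \<omega> [x, y])"
  using alt_form_linear[OF assms, of "[_, _]" 0] alt_form_linear[OF assms, of "[_, _]" 1]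
  by (simp add: bilinear_def)

lemma alt_form_2_self:
  assumes "alt_form 2 \<omega>"
  shows "\<omega> [x, x] = 0"
proof -
  have "\<And>xs i j. length xs = 2 \<Longrightarrow> i < j \<Longrightarrow> j < 2 \<Longrightarrow> xs ! i = xs ! j \<Longrightarrow> \<omega> xs = 0"
    using assms unfolding alt_form_def by blast
  from this[of "[x, x]" 0 1] show ?thesis by simp
qed

lemma alt_form_2_swap:
  assumes "alt_form 2 \<omega>"
  shows "\<omega> [x, y] = - \<omega> [y, x]"
  using bilinear_self_zero_swap[OF alt_form_2_bilinear[OF assms]] alt_form_2_self[OF assms] by blast

lemma length_2_conv: "length xs = 2 \<longleftrightarrow> (\<exists>x y. xs = [x, y])"
  by (auto simp: numeral_2_eq_2 length_Suc_conv)

lemma alt_form_2_eq_0_if_mem: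
  assumes "alt_form 2 \<omega>" "\<And>y. \<omega> [x, y] = 0" "x \<in> set ys"
  shows "\<omega> ys = 0"
proof (cases "length ys = 2")
  case True
  then show ?thesis
    using assms alt_form_2_swap[OF assms(1), of _ x] by (auto simp: length_2_conv)
next
  case False
  then show ?thesis
    using assms(1) unfolding alt_form_def by blast
qed

lemma alt_form_1_eq_0_if_mem:
  assumes "alt_form 1 \<eta>" "\<eta> [x] = 0" "x \<in> set ys"
  shows "\<eta> ys = 0"
proof (cases "length ys = 1")
  case True
  then show ?thesis
    using assms by (auto simp: length_Suc_conv)
next
  case False
  then show ?thesis
    using assms(1) unfolding alt_form_def by blast
qed

text \<open>Arguments with a nonzero value of \<eta> \<and> \<omega>^m form a basis. Expand a
  degenerate \<open>x\<close> in it: each coefficient times that value is a value of the form with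
  \<open>x\<close> among its arguments, hence 0.\<close>

lemma cosymplectic_nondegenerate:
  fixes \<eta> \<omega> :: "'a::real_vector list \<Rightarrow> real" and B :: "'a set"
  assumes "alt_form 1 \<eta>" "alt_form 2 \<omega>" "wedge_form \<eta> (wedge_power \<omega> m) \<noteq> (\<lambda>_. 0)"
    and "finite B" "span B = UNIV" "card B \<le> 1 + m * 2"
    and "\<eta> [x] = 0" "\<And>y. \<omega> [x, y] = 0"
  shows "x = 0"
proof -
  let ?\<psi> = "wedge_form \<eta> (wedge_power \<omega> m)"
  have alt: "alt_form (1 + m * 2) ?\<psi>"
    using assms by (intro alt_form_wedge_form alt_form_wedge_power)
  obtain xs where xs: "?\<psi> xs \<noteq> 0"
    using assms(3) by auto
  then have len: "length xs = 1 + m * 2"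
    using alt unfolding alt_form_def by blast
  obtain c where c: "x = (\<Sum>j<1 + m * 2. c j *\<^sub>R xs ! j)"
    using alt_form_nonzero_spans[OF alt xs assms(4-6)] by blast
  have "c i = 0" if i: "i < 1 + m * 2" for i
  proof -
    have "c i * ?\<psi> xs = ?\<psi> (xs[i := x])"
      unfolding c by (rule alt_form_update_lincomb[OF alt len i, symmetric])
    also have "x \<in> set (xs[i := x])"
      using i len by (simp add: set_update_memI)
    then have "?\<psi> (xs[i := x]) = 0"
      by (intro wedge_form_eq_0_if_mem[of x] alt_form_1_eq_0_if_mem[OF assms(1,7)]
        wedge_power_eq_0_if_mem[of x] alt_form_2_eq_0_if_mem[OF assms(2,8)])
    finally show ?thesis
      using xs by simp
  qed
  then show ?thesis
    using c by simp
qed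

text \<open>Any resolution of the identity computes the trace: insert it into the diagonal
  coefficients, exchange the sums and reassemble \<open>v i\<close> from its coordinates. Later
  proofs thus need not know the basis chosen in \<open>lin_trace\<close>.\<close>

lemma lin_trace_frame:
  fixes f :: "'a::real_vector \<Rightarrow> 'a"
  assumes "finite I" "linear f" "\<And>i. i \<in> I \<Longrightarrow> linear (\<phi> i)"
    and frame: "\<And>x. x = (\<Sum>i\<in>I. \<phi> i x *\<^sub>R v i)"
  shows "lin_trace f = (\<Sum>i\<in>I. \<phi> i (f (v i)))"
proof -
  define B where "B = (SOME B::'a set. independent B \<and> span B = UNIV)"
  have "\<exists>B::'a set. independent B \<and> span B = UNIV"
    using maximal_independent_subset[of "UNIV :: 'a set"] by (metis top.extremum_uniqueI)
  then have B: "independent B" "span B = UNIV"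
    unfolding B_def by (metis (mono_tags, lifting) someI_ex)+
  have "x \<in> span (v ` I)" for x
    by (subst frame) (auto intro!: span_sum span_scale intro: span_base)
  then have fin: "finite B"
    using independent_span_bound[of "v ` I" B] B(1) assms(1) by blast
  have rep: "x = (\<Sum>b\<in>B. representation B x b *\<^sub>R b)" for x
    using sum_representation_eq[OF B(1) _ fin subset_refl, of x] B(2) by simp
  have rep_add: "representation B (\<Sum>i\<in>I. g i *\<^sub>R v i) b = (\<Sum>i\<in>I. g i * representation B (v i) b)" for g b
    using B by (simp add: representation_sum representation_scale)
  have "lin_trace f = (\<Sum>b\<in>B. representation B (f b) b)"
    by (simp add: lin_trace_def B_def Let_def)
  also have "\<dots> = (\<Sum>b\<in>B. \<Sum>i\<in>I. \<phi> i (f b) * representation B (v i) b)"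
  proof (rule sum.cong[OF refl])
    fix b
    show "representation B (f b) b = (\<Sum>i\<in>I. \<phi> i (f b) * representation B (v i) b)"
      by (subst frame[of "f b"]) (rule rep_add)
  qed
  also have "\<dots> = (\<Sum>i\<in>I. \<Sum>b\<in>B. representation B (v i) b * \<phi> i (f b))"
    by (subst sum.swap) (simp add: mult.commute)
  also have "\<dots> = (\<Sum>i\<in>I. \<phi> i (f (\<Sum>b\<in>B. representation B (v i) b *\<^sub>R b)))"
    using assms(2,3) by (intro sum.cong refl) (simp add: linear_sum linear_scale)
  also have "\<dots> = (\<Sum>i\<in>I. \<phi> i (f (v i)))"
    using rep by simp
  finally show ?thesis .
qed

section \<open>Linear algebra of a cosymplectic vector space\<close>

locale cosymplectic_vector_space =
  fixes \<eta> :: "'a::real_vector \<Rightarrow> real" and \<omega> :: "'a \<Rightarrow> 'a \<Rightarrow> real" and R :: 'a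
  assumes finite_spanning: "\<exists>B::'a set. finite B \<and> span B = UNIV"
    and linear_\<eta>: "linear \<eta>" and bilinear_\<omega>: "bilinear \<omega>" and \<omega>_self: "\<omega> x x = 0"
    and \<omega>_R: "\<omega> R y = 0" and \<eta>_R: "\<eta> R = 1"
    and nondegenerate: "\<eta> x = 0 \<Longrightarrow> (\<And>y. \<omega> x y = 0) \<Longrightarrow> x = 0"
begin

text \<open>The form behind the isomorphism x \<mapsto> i_x \<omega> + \<eta>(x) \<eta> of
  cosymplectic geometry; the rank-one term removes the kernel of \<omega>. In general it is neither
  symmetric nor antisymmetric, so its two slots must be kept apart.\<close>

definition \<beta> :: "'a \<Rightarrow> 'a \<Rightarrow> real" where
  "\<beta> x y = \<omega> x y + \<eta> x * \<eta> y"

lemma \<omega>_swap: "\<omega> x y = - \<omega> y x"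
  by (rule bilinear_self_zero_swap[OF bilinear_\<omega> \<omega>_self])

lemma \<omega>_R_right: "\<omega> x R = 0"
  using \<omega>_R \<omega>_swap[of x R] by simp

lemma linear_\<beta>_left: "linear (\<lambda>x. \<beta> x y)" and linear_\<beta>_right: "linear (\<lambda>y. \<beta> x y)"
  using bilinear_\<omega> linear_\<eta> unfolding bilinear_def linear_iff \<beta>_def by (auto simp: algebra_simps)

lemma \<beta>_R: "\<beta> x R = \<eta> x" "\<beta> R y = \<eta> y"
  by (simp_all add: \<beta>_def \<omega>_R \<omega>_R_right \<eta>_R)

text \<open>Inserting \<open>R\<close> isolates the value of \<eta> at \<open>y\<close>; what then
  remains of \<beta> is \<omega>.\<close>

lemma \<beta>_nondegenerate:
  assumes "\<And>x. \<beta> x y = 0"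
  shows "y = 0"
proof (rule nondegenerate)
  show y: "\<eta> y = 0"
    using assms[of R] by (simp add: \<beta>_R)
  show "\<omega> y x = 0" for x
    using assms[of x] y \<omega>_swap[of y x] by (simp add: \<beta>_def)
qed

text \<open>\<open>T\<close> sends \<open>y\<close> to the vector with coordinates
  \<open>\<beta> b y\<close>. It is injective by nondegeneracy and onto by dimension, and choosing
  \<open>v b\<close> as a preimage of \<open>b\<close> makes these vectors \<beta>-dual to
  \<open>B\<close>.\<close>

lemma dual_frame:
  obtains B v where "finite B" "card B = dim (UNIV :: 'a set)"
    "\<And>b. b \<in> B \<Longrightarrow> \<beta> b (v b) = 1"
    "\<And>x. x = (\<Sum>b\<in>B. \<beta> x (v b) *\<^sub>R b)" "\<And>x. x = (\<Sum>b\<in>B. \<beta> b x *\<^sub>R v b)"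
proof -
  obtain B :: "'a set" where fin: "finite B" and B: "independent B" "span B = UNIV"
      and card: "card B = dim (UNIV :: 'a set)"
    using finite_spanning finite_basis_exists by metis
  define T where "T y = (\<Sum>b\<in>B. \<beta> b y *\<^sub>R b)" for y
  have linT: "linear T"
    unfolding T_def
    by (rule linearI) (simp_all add: linear_add[OF linear_\<beta>_right] linear_scale[OF linear_\<beta>_right]
      scaleR_left_distrib sum.distrib scaleR_sum_right)
  have ext: "\<beta> x y = 0" if "\<And>b. b \<in> B \<Longrightarrow> \<beta> b y = 0" for x y
    using linear_eq_on_span[OF linear_\<beta>_left linear_zero, of B y x] that B(2) by simp
  have coeff: "c b = d b" if "(\<Sum>b\<in>B. c b *\<^sub>R b) = (\<Sum>b\<in>B. d b *\<^sub>R b)" "b \<in> B" for c d b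
  proof (rule ccontr)
    assume "c b \<noteq> d b"
    then have ne: "\<exists>b\<in>B. c b - d b \<noteq> 0"
      using that(2) by (intro bexI[of _ b]) simp_all
    have "(\<Sum>b\<in>B. (c b - d b) *\<^sub>R b) = 0"
      using that(1) by (simp add: scaleR_left_diff_distrib sum_subtractf)
    with ne have "dependent B"
      unfolding dependent_finite[OF fin] by (intro exI[of _ "\<lambda>b. c b - d b"] conjI)
    then show False
      using B(1) by simp
  qed
  have injT: "inj T"
    unfolding linear_injective_0[OF linT]
  proof (intro allI impI)
    fix y assume "T y = 0"
    then have "\<beta> b y = 0" if "b \<in> B" for b
      using coeff[of "\<lambda>b. \<beta> b y" "\<lambda>b. 0" b] that by (simp add: T_def)
    then show "y = 0"
      using ext \<beta>_nondegenerate by blast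
  qed
  have "independent (T ` B)"
    using linear_independent_injective_image[OF linT B(1)] injT by (simp add: inj_on_subset)
  then have "span (T ` B) = UNIV"
    using injT by (intro independent_card_ge_spans[OF fin B(2)]) (auto simp: card_image inj_on_subset)
  then have "surj T"
    using linear_span_image[OF linT, of B] B(2) by simp
  then obtain v where v: "\<And>b. T (v b) = b"
    by (metis surjD)
  have \<delta>: "\<beta> c (v b) = (if c = b then 1 else 0)" if "b \<in> B" "c \<in> B" for b c
  proof -
    have "(\<Sum>a\<in>B. \<beta> a (v b) *\<^sub>R a) = (\<Sum>a\<in>B. (if a = b then 1 else 0) *\<^sub>R a)"
      using v[of b] that(1) fin by (simp add: T_def if_distrib[of "\<lambda>r. r *\<^sub>R _"] cong: if_cong)
    from coeff[OF this that(2)] show ?thesis .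
  qed
  have 1: "x = (\<Sum>b\<in>B. \<beta> x (v b) *\<^sub>R b)" for x
  proof -
    have "linear (\<lambda>x. \<Sum>b\<in>B. \<beta> x (v b) *\<^sub>R b)"
      by (rule linearI) (simp_all add: linear_add[OF linear_\<beta>_left] linear_scale[OF linear_\<beta>_left]
        scaleR_left_distrib sum.distrib scaleR_sum_right)
    moreover have "c = (\<Sum>b\<in>B. \<beta> c (v b) *\<^sub>R b)" if "c \<in> B" for c
    proof -
      have "(\<Sum>b\<in>B. \<beta> c (v b) *\<^sub>R b) = (\<Sum>b\<in>B. if c = b then b else 0)"
        using that by (intro sum.cong refl) (simp add: \<delta>)
      then show ?thesis
        using that fin by simp
    qed
    ultimately show ?thesis
      using linear_eq_on_span[OF linear_ident, of "\<lambda>x. \<Sum>b\<in>B. \<beta> x (v b) *\<^sub>R b" B x] B(2) by simp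
  qed
  \<comment> \<open>\<open>T\<close> takes both sides to the same vector, and it is
    injective.\<close>
  have 2: "x = (\<Sum>b\<in>B. \<beta> b x *\<^sub>R v b)" for x
  proof -
    have "T (\<Sum>b\<in>B. \<beta> b x *\<^sub>R v b) = T x"
      by (simp add: linear_sum[OF linT] linear_scale[OF linT] v) (simp add: T_def)
    then show ?thesis
      using injT by (simp add: inj_eq)
  qed
  show thesis
    using that[of B v] fin card 1 2 \<delta> by simp
qed

text \<open>Both the basis and its \<open>\<beta>\<close>-dual basis compute the trace, and the hypothesis exchanges the two
  expressions up to sign and correction terms in \<open>\<eta>\<close>; adding them yields twice the trace.\<close>

lemma lin_trace_conformal:
  assumes "linear D" and D: "\<And>x y. \<omega> (D x) y + \<omega> x (D y) = a * \<omega> x y"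
  shows "2 * lin_trace D = a * (real (dim (UNIV :: 'a set)) - 1) + 2 * \<eta> (D R)"
proof -
  obtain B v where B: "finite B" "card B = dim (UNIV :: 'a set)"
    and one: "\<And>b. b \<in> B \<Longrightarrow> \<beta> b (v b) = 1"
    and e1: "\<And>x. x = (\<Sum>b\<in>B. \<beta> x (v b) *\<^sub>R b)" and e2: "\<And>x. x = (\<Sum>b\<in>B. \<beta> b x *\<^sub>R v b)"
    by (rule dual_frame) blast
  have t1: "lin_trace D = (\<Sum>b\<in>B. \<beta> (D b) (v b))"
    by (rule lin_trace_frame[OF B(1) assms(1) linear_\<beta>_left e1])
  have t2: "lin_trace D = (\<Sum>b\<in>B. \<beta> b (D (v b)))"
    by (rule lin_trace_frame[OF B(1) assms(1) linear_\<beta>_right e2])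
  \<comment> \<open>With \<open>R\<close> in either slot \<beta> reduces to \<eta>, so both
    expansions of \<open>R\<close> have values of \<eta> as coefficients. Applying \<eta>, or \<eta>
    after \<open>D\<close>, to them evaluates the sums below.\<close>
  have R1: "(\<Sum>b\<in>B. \<eta> (v b) *\<^sub>R b) = R" and R2: "(\<Sum>b\<in>B. \<eta> b *\<^sub>R v b) = R"
    using e1[of R, symmetric] e2[of R, symmetric] unfolding \<beta>_R .
  have lin: "linear (\<lambda>x. \<eta> (D x))"
    using linear_compose[OF assms(1) linear_\<eta>] by (simp add: o_def)
  have s1: "(\<Sum>b\<in>B. \<eta> b * \<eta> (v b)) = 1"
    using arg_cong[OF R2, of \<eta>] by (simp add: linear_sum[OF linear_\<eta>] linear_scale[OF linear_\<eta>] \<eta>_R)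
  have s2: "(\<Sum>b\<in>B. \<eta> b * \<eta> (D (v b))) = \<eta> (D R)"
    using arg_cong[OF R2, of "\<lambda>x. \<eta> (D x)"] by (simp add: linear_sum[OF lin] linear_scale[OF lin])
  have s3: "(\<Sum>b\<in>B. \<eta> (D b) * \<eta> (v b)) = \<eta> (D R)"
    using arg_cong[OF R1, of "\<lambda>x. \<eta> (D x)"]
    by (simp add: linear_sum[OF lin] linear_scale[OF lin] mult.commute)
  \<comment> \<open>The hypothesis rewritten with \<omega> as \<beta> minus a product of values of
    \<eta>. Summed over \<open>B\<close>, the corrections give - a and twice \<eta>(D R).\<close>
  have "\<beta> (D b) (v b) + \<beta> b (D (v b)) =
      a * \<beta> b (v b) - a * (\<eta> b * \<eta> (v b)) + \<eta> (D b) * \<eta> (v b) + \<eta> b * \<eta> (D (v b))" for b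
    using D[of b "v b"] by (simp add: \<beta>_def algebra_simps)
  then have "(\<Sum>b\<in>B. \<beta> (D b) (v b)) + (\<Sum>b\<in>B. \<beta> b (D (v b))) =
      (\<Sum>b\<in>B. a * \<beta> b (v b) - a * (\<eta> b * \<eta> (v b)) + \<eta> (D b) * \<eta> (v b) + \<eta> b * \<eta> (D (v b)))"
    by (simp add: sum.distrib[symmetric])
  also have "\<dots> = a * (\<Sum>b\<in>B. \<beta> b (v b)) - a * (\<Sum>b\<in>B. \<eta> b * \<eta> (v b)) +
      (\<Sum>b\<in>B. \<eta> (D b) * \<eta> (v b)) + (\<Sum>b\<in>B. \<eta> b * \<eta> (D (v b)))"
    by (simp add: sum.distrib sum_subtractf sum_distrib_left)
  also have "(\<Sum>b\<in>B. \<beta> b (v b)) = real (dim (UNIV :: 'a set))"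
    using one B(2) by simp
  finally show ?thesis
    using t1 t2 s1 s2 s3 by (simp add: algebra_simps)
qed

text \<open>The dual basis represents \<mu> through \<beta>. Evaluation at \<open>R\<close> gives
  \<eta>(x) = \<mu>(R) = 0, and for such \<open>x\<close> the forms \<beta> and \<omega>
  agree.\<close>

lemma covector_represented:
  assumes "linear \<mu>" "\<mu> R = 0"
  obtains x where "\<And>y. \<omega> x y = \<mu> y"
proof -
  obtain B v where B: "finite B" "card B = dim (UNIV :: 'a set)"
    and e2: "\<And>x. x = (\<Sum>b\<in>B. \<beta> b x *\<^sub>R v b)"
    by (rule dual_frame) blast
  define x where "x = (\<Sum>b\<in>B. \<mu> (v b) *\<^sub>R b)"
  have \<beta>x: "\<beta> x y = \<mu> y" for y
  proof -
    have "\<beta> x y = (\<Sum>b\<in>B. \<mu> (v b) * \<beta> b y)"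
      unfolding x_def by (simp add: linear_sum[OF linear_\<beta>_left] linear_scale[OF linear_\<beta>_left])
    also have "\<dots> = \<mu> (\<Sum>b\<in>B. \<beta> b y *\<^sub>R v b)"
      by (simp add: linear_sum[OF assms(1)] linear_scale[OF assms(1)] mult.commute)
    finally show ?thesis
      using e2[of y] by simp
  qed
  then have "\<eta> x = 0"
    using assms(2) \<beta>_R(1)[of x] by simp
  then show thesis
    using that[of x] \<beta>x by (simp add: \<beta>_def)
qed

end

section \<open>The semidirect product\<close>

lemma alt_form_add:
  assumes "alt_form k \<phi>" "alt_form k \<psi>"
  shows "alt_form k (\<lambda>xs. \<phi> xs + \<psi> xs)"
  using assms unfolding alt_form_def by (auto intro!: linear_compose_add)

lemma alt_form_pullback:
  fixes f :: "'a::real_vector \<Rightarrow> 'b::real_vector"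
  assumes "alt_form k \<phi>" "linear f"
  shows "alt_form k (pullback_form f \<phi>)"
  unfolding alt_form_def pullback_form_def
proof (intro conjI allI impI; (elim conjE)?)
  fix xs :: "'a list" and i
  assume "length xs = k" "i < k"
  then have "linear (\<lambda>y. \<phi> ((map f xs)[i := y]))"
    by (intro alt_form_linear[OF assms(1)]) auto
  from linear_compose[OF assms(2) this] show "linear (\<lambda>x. \<phi> (map f (xs[i := x])))"
    by (simp add: o_def map_update)
next
  fix xs :: "'a list" and i j
  assume *: "length xs = k" "i < j" "j < k" "xs ! i = xs ! j"
  have "length (map f xs) = k \<and> i < j \<and> j < k \<and> map f xs ! i = map f xs ! j"
    using * by simp
  then show "\<phi> (map f xs) = 0"
    using assms(1) unfolding alt_form_def by blast
next
  fix xs :: "'a list"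
  assume "length xs \<noteq> k"
  then show "\<phi> (map f xs) = 0"
    using assms(1) unfolding alt_form_def by simp
qed

lemma alt_form_covector_form:
  assumes "linear f"
  shows "alt_form 1 (covector_form f)"
  using assms unfolding alt_form_def covector_form_def by (auto simp: length_Suc_conv)

lemma alt_form_1_eqI:
  assumes "alt_form 1 \<phi>" "alt_form 1 \<psi>" "\<And>x. \<phi> [x] = \<psi> [x]"
  shows "\<phi> = \<psi>"
proof
  fix xs
  show "\<phi> xs = \<psi> xs"
  proof (cases "length xs = 1")
    case True
    then show ?thesis
      using assms(3) by (auto simp: length_Suc_conv)
  next
    case False
    then show ?thesis
      using assms(1,2) unfolding alt_form_def by simp
  qed
qed

lemma alt_form_2_eqI:
  assumes "alt_form 2 \<phi>" "alt_form 2 \<psi>" "\<And>x y. \<phi> [x, y] = \<psi> [x, y]"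
  shows "\<phi> = \<psi>"
proof
  fix xs
  show "\<phi> xs = \<psi> xs"
  proof (cases "length xs = 2")
    case True
    then show ?thesis
      using assms(3) by (auto simp: length_2_conv)
  next
    case False
    then show ?thesis
      using assms(1,2) unfolding alt_form_def by simp
  qed
qed

lemma pullback_form_wedge_form:
  "pullback_form f (wedge_form \<phi> \<psi>) = wedge_form (pullback_form f \<phi>) (pullback_form f \<psi>)"
  by (auto simp: fun_eq_iff pullback_form_def wedge_form_def permute_list_map take_map drop_map
      intro!: sum.cong arg_cong2[where f = "(/)"])

lemma pullback_form_wedge_power:
  "pullback_form f (wedge_power \<phi> m) = wedge_power (pullback_form f \<phi>) m"
  by (induction m) (auto simp: pullback_form_wedge_form, simp add: pullback_form_def)

text \<open>Contraction annihilates the 0-form, so in an induction on the arguments only \<psi> is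
  contracted.\<close>

lemma wedge_form_0:
  assumes "alt_form 0 \<phi>" "alt_form q \<psi>"
  shows "wedge_form \<phi> \<psi> xs = \<phi> [] * \<psi> xs"
  using assms(2)
proof (induction xs arbitrary: q \<psi>)
  case (Cons x xs)
  have "wedge_form \<phi> \<psi> (x # xs) = wedge_form \<phi> (interior_form x \<psi>) xs"
    using fun_cong[OF interior_form_wedge_form[OF assms(1) Cons.prems], of x xs]
      interior_form_alt_0[OF assms(1), of x] by (simp add: interior_form_def[of x "wedge_form \<phi> \<psi>"])
  also have "\<dots> = \<phi> [] * interior_form x \<psi> xs"
  proof (cases q)
    case 0
    then show ?thesis
      using interior_form_alt_0[of \<psi> x] Cons.prems by simp
  next
    case (Suc q')
    then show ?thesis
      using Cons.IH[OF alt_form_interior_form[of q' \<psi> x]] Cons.prems by simp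
  qed
  finally show ?case
    by (simp add: interior_form_def)
qed (simp add: wedge_form_Nil)

text \<open>The contraction of a 1-form is a scalar. Iterating this expansion evaluates products of
  low degree without listing permutations.\<close>

lemma wedge_form_1_Cons:
  assumes "alt_form 1 \<phi>" "alt_form q \<psi>"
  shows "wedge_form \<phi> \<psi> (x # xs) = \<phi> [x] * \<psi> xs - wedge_form \<phi> (interior_form x \<psi>) xs"
proof -
  have "alt_form 0 (interior_form x \<phi>)"
    using assms(1) by (intro alt_form_interior_form) simp
  from wedge_form_0[OF this assms(2)] show ?thesis
    using fun_cong[OF interior_form_wedge_form[OF assms], of x xs] by (simp add: interior_form_def)
qed

lemma wedge_form_1_1:
  assumes "alt_form 1 \<phi>" "alt_form 1 \<psi>"
  shows "wedge_form \<phi> \<psi> [x, y] = \<phi> [x] * \<psi> [y] - \<phi> [y] * \<psi> [x]"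
proof -
  have i: "alt_form 0 (interior_form x \<psi>)"
    using assms(2) by (intro alt_form_interior_form) simp
  show ?thesis
    using wedge_form_1_Cons[OF assms, of x "[y]"] wedge_form_1_Cons[OF assms(1) i, of y "[]"]
      interior_form_alt_0[OF i, of y] by (simp add: interior_form_def)
qed

lemma wedge_form_1_2:
  assumes "alt_form 1 \<phi>" "alt_form 2 \<psi>"
  shows "wedge_form \<phi> \<psi> [x, y, z] = \<phi> [x] * \<psi> [y, z] - \<phi> [y] * \<psi> [x, z] + \<phi> [z] * \<psi> [x, y]"
proof -
  have i: "alt_form 1 (interior_form x \<psi>)"
    using assms(2) by (intro alt_form_interior_form) (simp add: numeral_2_eq_2)
  show ?thesis
    using wedge_form_1_Cons[OF assms, of x "[y, z]"] wedge_form_1_1[OF assms(1) i, of y z]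
    by (simp add: interior_form_def)
qed

lemma ce_diff_2: "ce_diff br \<phi> [x, y] = - \<phi> [br x y]"
  by (simp add: ce_diff_def lessThan_Suc nths_Cons numeral_2_eq_2)

lemma ce_diff_3: "ce_diff br \<phi> [x, y, z] = - \<phi> [br x y, z] + \<phi> [br x z, y] - \<phi> [br y z, x]"
  by (simp add: ce_diff_def lessThan_Suc nths_Cons numeral_2_eq_2)

lemma ce_diff_wrong_length:
  assumes "\<And>ys. length ys \<noteq> k \<Longrightarrow> \<phi> ys = 0" "length xs \<noteq> Suc k"
  shows "ce_diff br \<phi> xs = 0"
proof -
  have "\<phi> (br (xs ! i) (xs ! j) # nths xs (- {i, j})) = 0" if "i < j" "j < length xs" for i j
  proof (rule assms(1))
    \<comment> \<open>\<open>nths\<close> drops exactly two positions, so with the bracket in front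
      the argument list is one shorter than \<open>xs\<close>.\<close>
    have "{l. l < length xs \<and> l \<in> - {i, j}} = {..<length xs} - {i, j}"
      by auto
    then have "length (nths xs (- {i, j})) = length xs - 2"
      using that by (simp add: length_nths)
    then show "length (br (xs ! i) (xs ! j) # nths xs (- {i, j})) \<noteq> k"
      using that assms(2) by simp
  qed
  then show ?thesis
    unfolding ce_diff_def by simp
qed

section \<open>Bases and traces on the product with the real line\<close>

lemma representation_frame:
  fixes B :: "'a::real_vector set"
  assumes "finite B" "independent B" "span B = UNIV"
  shows "linear (\<lambda>x. representation B x b)" "x = (\<Sum>b\<in>B. representation B x b *\<^sub>R b)"
proof -
  show "linear (\<lambda>x. representation B x b)"
    using assms by (intro linearI) (simp_all add: representation_add representation_scale)
  show "x = (\<Sum>b\<in>B. representation B x b *\<^sub>R b)"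
    using sum_representation_eq[OF assms(2) _ assms(1) subset_refl, of x] assms(3) by simp
qed

lemma span_Pair_0: "span ((\<lambda>x. (x, 0)) ` B) = (\<lambda>x. (x, 0 :: real)) ` span (B :: 'a::real_vector set)"
  by (rule linear_span_image) (simp add: linear_iff)

lemma basis_prod_real:
  fixes B :: "'a::real_vector set"
  assumes "finite B" "independent B" "span B = UNIV"
  defines "C \<equiv> insert (0, 1 :: real) ((\<lambda>x. (x, 0)) ` B)"
  shows "finite C" "independent C" "span C = UNIV" "card C = Suc (card B)"
proof -
  have lin: "linear (\<lambda>x::'a. (x, 0 :: real))"
    by (simp add: linear_iff)
  have inj: "inj (\<lambda>x::'a. (x, 0 :: real))"
    by (simp add: inj_on_def)
  have sp: "span ((\<lambda>x. (x, 0 :: real)) ` B) = range (\<lambda>x. (x, 0))"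
    using span_Pair_0[of B] assms(3) by simp
  show "finite C"
    unfolding C_def using assms(1) by simp
  show "independent C"
    unfolding C_def using sp
    by (intro independent_insertI linear_independent_injective_image[OF lin] assms(2)) (auto simp: inj_on_def)
  show "card C = Suc (card B)"
    unfolding C_def using assms(1) inj by (subst card_insert_disjoint) (auto simp: card_image inj_on_def)
  have "(x, a) \<in> span C" for x a
  proof -
    have "(x, 0) \<in> span ((\<lambda>x. (x, 0 :: real)) ` B)"
      using sp by simp
    then have "(x, 0) \<in> span C"
      unfolding C_def by (meson span_mono subset_insertI subsetD)
    moreover have "a *\<^sub>R (0, 1) \<in> span C"
      unfolding C_def by (intro span_scale span_base) simp
    ultimately have "(x, 0) + a *\<^sub>R (0, 1) \<in> span C"
      by (rule span_add)
    then show ?thesis by simp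
  qed
  then show "span C = UNIV"
    by auto
qed

text \<open>Only the diagonal blocks of \<open>F\<close> count, as a frame adapted to the product
  shows.\<close>

lemma lin_trace_prod_real:
  fixes F :: "'a::real_vector \<times> real \<Rightarrow> 'a \<times> real" and C :: "'a set"
  assumes "finite C" "span C = UNIV" "linear F"
  shows "lin_trace F = lin_trace (\<lambda>x. fst (F (x, 0))) + snd (F (0, 1))"
proof -
  obtain B :: "'a set" where B: "finite B" "independent B" "span B = UNIV"
    using finite_basis_exists[OF assms(1,2)] by blast
  note rep = representation_frame[OF B]
  \<comment> \<open>\<open>None\<close> indexes the real direction and \<open>Some b\<close> the
    basis vector \<open>b\<close> of the first factor.\<close>
  define I where "I = insert None (Some ` B)"
  define \<phi> where "\<phi> i = (case i of None \<Rightarrow> snd | Some b \<Rightarrow> (\<lambda>u. representation B (fst u) b))"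
    for i :: "'a option"
  define v where "v i = (case i of None \<Rightarrow> (0, 1) | Some b \<Rightarrow> (b, 0 :: real))" for i :: "'a option"
  have sum_I: "(\<Sum>i\<in>I. g i) = g None + (\<Sum>b\<in>B. g (Some b))"
    for g :: "'a option \<Rightarrow> 'b::comm_monoid_add"
    unfolding I_def using B(1) by (subst sum.insert) (auto simp: sum.reindex)
  have "lin_trace F = (\<Sum>i\<in>I. \<phi> i (F (v i)))"
  proof (rule lin_trace_frame[OF _ assms(3)])
    show "finite I"
      unfolding I_def using B(1) by simp
    show "linear (\<phi> i)" for i
      using linear_compose[OF linear_fst rep(1)] linear_snd
      by (cases i) (simp_all add: \<phi>_def o_def)
    show "x = (\<Sum>i\<in>I. \<phi> i x *\<^sub>R v i)" for x
      unfolding sum_I using rep(2)[of "fst x"]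
      by (simp add: \<phi>_def v_def prod_eq_iff fst_sum snd_sum)
  qed
  also have "\<dots> = snd (F (0, 1)) + (\<Sum>b\<in>B. representation B (fst (F (b, 0))) b)"
    unfolding sum_I by (simp add: \<phi>_def v_def)
  also have "(\<Sum>b\<in>B. representation B (fst (F (b, 0))) b) = lin_trace (\<lambda>x. fst (F (x, 0)))"
  proof (rule lin_trace_frame[OF B(1) _ rep, symmetric])
    have "linear (\<lambda>x. (x, 0 :: real))"
      by (simp add: linear_iff)
    then show "linear (\<lambda>x. fst (F (x, 0)))"
      using linear_compose[OF linear_compose[OF _ assms(3)] linear_fst] by (simp add: o_def)
  qed
  finally show ?thesis by simp
qed

lemma lin_trace_lincomb:
  fixes f g :: "'a::real_vector \<Rightarrow> 'a" and C :: "'a set"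
  assumes "finite C" "span C = UNIV" "linear f" "linear g"
  shows "lin_trace (\<lambda>x. a *\<^sub>R f x + g x) = a * lin_trace f + lin_trace g"
proof -
  obtain B :: "'a set" where B: "finite B" "independent B" "span B = UNIV"
    using finite_basis_exists[OF assms(1,2)] by blast
  note frame = lin_trace_frame[OF B(1) _ representation_frame[OF B]]
  have "linear (\<lambda>x. a *\<^sub>R f x + g x)"
    using assms(3,4) by (intro linear_compose_add linear_compose_scale_right)
  from frame[OF this] frame[OF assms(3)] frame[OF assms(4)] show ?thesis
    using B by (simp add: representation_add representation_scale sum.distrib sum_distrib_left)
qed

section \<open>The given data and the Lie algebra \<open>brg\<close>\<close>

locale cosymplectic_derivation =
  fixes n :: nat and br :: "'a::real_vector \<Rightarrow> 'a \<Rightarrow> 'a" and \<eta> \<omega> :: "'a list \<Rightarrow> real"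
    and R :: 'a and D :: "'a \<Rightarrow> 'a" and \<alpha> :: real
  assumes n: "n \<ge> 2"
    and cosymplectic: "cosymplectic_structure n br \<eta> \<omega>"
    and reeb: "reeb_vector \<eta> \<omega> R"
    and derivation: "lie_derivation br D"
    and \<alpha>: "\<alpha> \<noteq> 0"
    and conformal: "derivation_action D \<omega> = (\<lambda>xs. \<alpha> * \<omega> xs)"
begin

abbreviation "brg \<equiv> semidirect_bracket br D"

definition \<theta> :: "('a \<times> real) list \<Rightarrow> real" where
  "\<theta> = covector_form (\<lambda>(X, a). - \<alpha> * a)"

definition \<Omega> :: "('a \<times> real) list \<Rightarrow> real" where
  "\<Omega> xs = pullback_form fst \<omega> xs + wedge_form (pullback_form fst \<eta>) \<theta> xs"

lemma lie: "fd_lie_algebra br" and dim_h: "dim (UNIV :: 'a set) + 1 = 2 * n"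
  and alt_\<eta>: "alt_form 1 \<eta>" and alt_\<omega>: "alt_form 2 \<omega>"
  and d\<eta>: "ce_diff br \<eta> = (\<lambda>_. 0)" and d\<omega>: "ce_diff br \<omega> = (\<lambda>_. 0)"
  and volume: "wedge_form \<eta> (wedge_power \<omega> (n - 1)) \<noteq> (\<lambda>_. 0)"
  using cosymplectic unfolding cosymplectic_structure_def by auto

lemma finite_spanning: "\<exists>B::'a set. finite B \<and> span B = UNIV" and bilinear_br: "bilinear br"
  and br_self: "br x x = 0"
  and jacobi: "br x (br y z) + br y (br z x) + br z (br x y) = 0"
  using lie unfolding fd_lie_algebra_def by auto

lemma linear_D: "linear D" and D_br: "D (br x y) = br (D x) y + br x (D y)"
  using derivation unfolding lie_derivation_def by auto

lemma br_swap: "br x y = - br y x"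
proof -
  have "br (x + y) (x + y) = br x x + br x y + (br y x + br y y)"
    by (simp add: bilinear_ladd[OF bilinear_br] bilinear_radd[OF bilinear_br])
  then show ?thesis
    using br_self by (simp add: eq_neg_iff_add_eq_0)
qed

lemma linear_\<eta>: "linear (\<lambda>x. \<eta> [x])"
  by (rule alt_form_1_linear[OF alt_\<eta>])

lemma bilinear_\<omega>: "bilinear (\<lambda>x y. \<omega> [x, y])"
  by (rule alt_form_2_bilinear[OF alt_\<omega>])

lemmas \<omega>_swap = alt_form_2_swap[OF alt_\<omega>]

lemmas br_simps = bilinear_ladd[OF bilinear_br] bilinear_radd[OF bilinear_br]
  bilinear_lsub[OF bilinear_br] bilinear_rsub[OF bilinear_br]
  bilinear_lmul[OF bilinear_br] bilinear_rmul[OF bilinear_br]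
  bilinear_lzero[OF bilinear_br] bilinear_rzero[OF bilinear_br]

lemmas D_simps = linear_add[OF linear_D] linear_diff[OF linear_D] linear_scale[OF linear_D] linear_0[OF linear_D]

lemmas \<eta>_simps = linear_add[OF linear_\<eta>] linear_diff[OF linear_\<eta>] linear_scale[OF linear_\<eta>] linear_0[OF linear_\<eta>]

lemmas \<omega>_simps = bilinear_ladd[OF bilinear_\<omega>] bilinear_radd[OF bilinear_\<omega>]
  bilinear_lsub[OF bilinear_\<omega>] bilinear_rsub[OF bilinear_\<omega>]
  bilinear_lmul[OF bilinear_\<omega>] bilinear_rmul[OF bilinear_\<omega>]
  bilinear_lzero[OF bilinear_\<omega>] bilinear_rzero[OF bilinear_\<omega>]

lemma \<eta>_br: "\<eta> [br x y] = 0"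
  using fun_cong[OF d\<eta>, of "[x, y]"] by (simp add: ce_diff_2)

lemma \<omega>_closed: "\<omega> [br x y, z] = \<omega> [br x z, y] - \<omega> [br y z, x]"
  using fun_cong[OF d\<omega>, of "[x, y, z]"] by (simp add: ce_diff_3)

lemma \<omega>_D: "\<omega> [D x, y] + \<omega> [x, D y] = \<alpha> * \<omega> [x, y]"
  using fun_cong[OF conformal, of "[x, y]"] by (simp add: derivation_action_2)

text \<open>Makes the trace formula and the representation of covectors available on h, for
  \<open>D\<close> as well as for adjoint maps. Nondegeneracy comes from the volume form.\<close>

sublocale cosymplectic_vector_space "\<lambda>x. \<eta> [x]" "\<lambda>x y. \<omega> [x, y]" R
proof
  show "\<omega> [R, y] = 0" for y
    using fun_cong[OF conjunct1[OF reeb[unfolded reeb_vector_def]], of "[y]"] by (simp add: interior_form_def)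
  show "\<eta> [R] = 1"
    using reeb unfolding reeb_vector_def by simp
  obtain B :: "'a set" where B: "finite B" "span B = UNIV" "card B = dim (UNIV :: 'a set)"
    using finite_spanning finite_basis_exists by metis
  \<comment> \<open>The dimension 2n - 1 is the degree of \<eta> \<and> \<omega>^(n - 1).\<close>
  have "card B \<le> 1 + (n - 1) * 2"
    using B(3) dim_h n by simp
  then show "x = 0" if "\<eta> [x] = 0" "\<And>y. \<omega> [x, y] = 0" for x
    using cosymplectic_nondegenerate[OF alt_\<eta> alt_\<omega> volume B(1,2)] that by blast
qed (use finite_spanning bilinear_\<omega> in \<open>simp_all add: \<eta>_simps alt_form_2_self[OF alt_\<omega>]\<close>)

lemma brg_Pair: "brg (X, a) (Y, b) = (a *\<^sub>R D Y - b *\<^sub>R D X + br X Y, 0)"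
  by (simp add: semidirect_bracket_def)

lemma bilinear_brg: "bilinear brg"
  by (auto simp: bilinear_def linear_iff brg_Pair br_simps D_simps algebra_simps)

text \<open>The Jacobi identity splits by degree in the real components: degree 0 is the identity of
  h, degree 1 cancels by the Leibniz rule for \<open>D\<close> and antisymmetry, and in degree 2 the
  terms with D^2 cancel in pairs.\<close>

lemma fd_lie_algebra_brg: "fd_lie_algebra brg"
  unfolding fd_lie_algebra_def
proof (intro conjI allI)
  obtain B :: "'a set" where "finite B" "independent B" "span B = UNIV"
    using finite_spanning finite_basis_exists by metis
  from basis_prod_real[OF this] show "\<exists>B::('a \<times> real) set. finite B \<and> span B = UNIV"
    by blast
  show "brg u u = 0" for u
    by (cases u) (simp add: brg_Pair br_self zero_prod_def)
  fix u v w :: "'a \<times> real"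
  obtain X a Y b Z c where uvw: "u = (X, a)" "v = (Y, b)" "w = (Z, c)"
    by (metis surj_pair)
  have "br X (br Y Z) + (br Y (br Z X) + br Z (br X Y)) = 0"
    using jacobi[of X Y Z] by (simp add: add.assoc)
  then show "brg u (brg v w) + brg v (brg w u) + brg w (brg u v) = 0"
    unfolding uvw using br_swap[of "D X" Y] br_swap[of "D X" Z] br_swap[of "D Y" X]
      br_swap[of "D Y" Z] br_swap[of "D Z" X] br_swap[of "D Z" Y]
    by (simp add: brg_Pair br_simps D_simps D_br zero_prod_def algebra_simps)
qed (rule bilinear_brg)

lemma dim_g: "dim (UNIV :: ('a \<times> real) set) = 2 * n"
proof -
  obtain B :: "'a set" where B: "finite B" "independent B" "span B = UNIV" "card B = dim (UNIV :: 'a set)"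
    using finite_spanning finite_basis_exists by metis
  show ?thesis
    using basis_prod_real[OF B(1-3)] dim_eq_card[of _ "UNIV :: ('a \<times> real) set"] B(4) dim_h by simp
qed

section \<open>The lcs structure\<close>

lemma alt_\<theta>: "alt_form 1 \<theta>"
  unfolding \<theta>_def by (rule alt_form_covector_form) (auto simp: linear_iff algebra_simps)

lemma \<theta>_Pair: "\<theta> [(X, a)] = - \<alpha> * a"
  by (simp add: \<theta>_def covector_form_def)

lemma alt_pullback_\<eta>: "alt_form 1 (pullback_form (fst :: 'a \<times> real \<Rightarrow> 'a) \<eta>)"
  by (rule alt_form_pullback[OF alt_\<eta> linear_fst])

lemma alt_\<Omega>: "alt_form 2 \<Omega>"
proof -
  have "alt_form 2 (wedge_form (pullback_form fst \<eta>) \<theta>)"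
    using alt_form_wedge_form[OF alt_pullback_\<eta> alt_\<theta>] by (simp add: numeral_2_eq_2)
  then show ?thesis
    unfolding \<Omega>_def[abs_def] by (intro alt_form_add alt_form_pullback[OF alt_\<omega> linear_fst])
qed

lemma \<Omega>_Pair: "\<Omega> [(X, a), (Y, b)] = \<omega> [X, Y] - \<alpha> * b * \<eta> [X] + \<alpha> * a * \<eta> [Y]"
  by (simp add: \<Omega>_def wedge_form_1_1[OF alt_pullback_\<eta> alt_\<theta>] \<theta>_Pair pullback_form_def)

lemma ce_diff_\<theta>: "ce_diff brg \<theta> = (\<lambda>_. 0)"
proof
  fix xs :: "('a \<times> real) list"
  show "ce_diff brg \<theta> xs = 0"
  proof (cases "length xs = 2")
    case True
    then obtain X a Y b where "xs = [(X, a), (Y, b)]"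
      by (auto simp: length_2_conv)
    then show ?thesis
      by (simp add: ce_diff_2 brg_Pair \<theta>_Pair)
  next
    case False
    then show ?thesis
      using alt_\<theta> unfolding alt_form_def by (intro ce_diff_wrong_length[of 1]) auto
  qed
qed

text \<open>On triples, closedness of \<eta> and \<omega> removes the brackets of h, conformality
  turns the terms with \<open>D\<close> inside \<omega> into \<theta> \<and> \<omega>, and those
  with \<open>D\<close> inside \<eta> cancel in pairs. The part \<theta> \<and> \<eta> \<and>
  \<theta> of the right side vanishes.\<close>

lemma ce_diff_\<Omega>: "ce_diff brg \<Omega> = wedge_form \<theta> \<Omega>"
proof
  fix xs :: "('a \<times> real) list"
  show "ce_diff brg \<Omega> xs = wedge_form \<theta> \<Omega> xs"
  proof (cases "length xs = 3")
    case True
    then obtain X a Y b Z c where xs: "xs = [(X, a), (Y, b), (Z, c)]"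
      by (auto simp: numeral_3_eq_3 length_Suc_conv)
    have D: "\<omega> [D x, y] = \<alpha> * \<omega> [x, y] - \<omega> [x, D y]" for x y
      using \<omega>_D[of x y] by simp
    have "\<omega> [Y, D X] = - \<omega> [D X, Y]" "\<omega> [Z, D X] = - \<omega> [D X, Z]" "\<omega> [Z, D Y] = - \<omega> [D Y, Z]"
      "\<omega> [Y, X] = - \<omega> [X, Y]" "\<omega> [Z, X] = - \<omega> [X, Z]" "\<omega> [Z, Y] = - \<omega> [Y, Z]"
      by (rule \<omega>_swap)+
    then show ?thesis
      unfolding xs ce_diff_3 wedge_form_1_2[OF alt_\<theta> alt_\<Omega>] brg_Pair \<Omega>_Pair \<theta>_Pair
      by (simp add: \<omega>_simps \<eta>_simps \<eta>_br \<omega>_closed[of X Y Z] D) (simp add: algebra_simps)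
  next
    case False
    have "ce_diff brg \<Omega> xs = 0"
      using alt_\<Omega> False unfolding alt_form_def by (intro ce_diff_wrong_length[of 2]) auto
    moreover have "wedge_form \<theta> \<Omega> xs = 0"
      using False by (intro wedge_form_wrong_length[OF alt_\<theta> alt_\<Omega>]) simp
    ultimately show ?thesis by simp
  qed
qed

lemma volume_\<Omega>: "wedge_power \<Omega> n \<noteq> (\<lambda>_. 0)"
proof
  assume zero: "wedge_power \<Omega> n = (\<lambda>_. 0)"
  obtain m where m: "n = Suc m"
    using n by (cases n) auto
  let ?inc = "\<lambda>x::'a. (x, 0 :: real)"
  have lin: "linear ?inc"
    by (simp add: linear_iff)
  have \<omega>: "pullback_form ?inc \<Omega> = \<omega>"
    by (rule alt_form_2_eqI[OF alt_form_pullback[OF alt_\<Omega> lin] alt_\<omega>])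
      (simp add: pullback_form_def \<Omega>_Pair)
  have i: "alt_form 1 (interior_form (0, 1) \<Omega>)"
    using alt_\<Omega> by (intro alt_form_interior_form) (simp add: numeral_2_eq_2)
  have "alt_form 1 (\<lambda>xs. \<alpha> * \<eta> xs)"
    using alt_\<eta> unfolding alt_form_def by (auto simp: linear_iff algebra_simps)
  \<comment> \<open>For a second argument in h, only the term of \<Omega> carrying the real
    component 1 of the first argument survives.\<close>
  then have \<eta>: "pullback_form ?inc (interior_form (0, 1) \<Omega>) = (\<lambda>xs. \<alpha> * \<eta> xs)"
    by (rule alt_form_1_eqI[OF alt_form_pullback[OF i lin]])
      (simp add: pullback_form_def interior_form_def \<Omega>_Pair \<omega>_simps \<eta>_simps)
  have "pullback_form ?inc (interior_form (0, 1) (wedge_power \<Omega> n)) =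
      (\<lambda>xs. real n * pullback_form ?inc (wedge_form (interior_form (0, 1) \<Omega>) (wedge_power \<Omega> m)) xs)"
    unfolding m interior_form_wedge_power[OF alt_\<Omega>] by (simp add: pullback_form_def fun_eq_iff)
  also have "\<dots> = (\<lambda>xs. real n * (\<alpha> * wedge_form \<eta> (wedge_power \<omega> (n - 1)) xs))"
    unfolding pullback_form_wedge_form pullback_form_wedge_power \<omega> \<eta> wedge_form_scale_left m by simp
  finally have *: "real n * (\<alpha> * wedge_form \<eta> (wedge_power \<omega> (n - 1)) xs) = 0" for xs
    unfolding zero by (metis interior_form_def pullback_form_def)
  have "wedge_form \<eta> (wedge_power \<omega> (n - 1)) = (\<lambda>_. 0)"
    using * n \<alpha> by (simp add: fun_eq_iff)
  then show False
    using volume by simp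
qed

lemma lcs: "lcs_structure n brg \<Omega> \<theta>"
  unfolding lcs_structure_def
  using fd_lie_algebra_brg n dim_g alt_\<Omega> alt_\<theta> volume_\<Omega> ce_diff_\<theta> ce_diff_\<Omega> by blast

section \<open>Unimodularity and non-exactness\<close>

lemma linear_br: "linear (br X)"
  using bilinear_br unfolding bilinear_def by simp

text \<open>The adjoint map of (X, a) acts on h as a D + ad X, and its values have real component 0,
  so the other diagonal block vanishes.\<close>

lemma lin_trace_brg: "lin_trace (brg (X, a)) = a * lin_trace D + lin_trace (br X)"
proof -
  obtain B :: "'a set" where B: "finite B" "span B = UNIV"
    using finite_spanning by blast
  have "linear (brg (X, a))"
    using bilinear_brg unfolding bilinear_def by simp
  then show ?thesis
    using lin_trace_prod_real[OF B, of "brg (X, a)"] lin_trace_lincomb[OF B linear_D linear_br, of a X]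
    by (simp add: brg_Pair)
qed

lemma unimodular_brg_iff: "unimodular_lie brg \<longleftrightarrow> unimodular_lie br \<and> lin_trace D = 0"
proof
  assume u: "unimodular_lie brg"
  have tr: "a * lin_trace D + lin_trace (br X) = 0" for X a
    using u lin_trace_brg[of X a] unfolding unimodular_lie_def by simp
  then have "lin_trace (br X) = 0" for X
    using tr[of 0 X] by simp
  then show "unimodular_lie br \<and> lin_trace D = 0"
    using tr[of 1 0] unfolding unimodular_lie_def by simp
next
  assume "unimodular_lie br \<and> lin_trace D = 0"
  then show "unimodular_lie brg"
    unfolding unimodular_lie_def by (simp add: lin_trace_brg split_paired_all)
qed

lemma lin_trace_D: "lin_trace D = \<alpha> * (real n - 1) + \<eta> [D R]"
proof -
  have "real (dim (UNIV :: 'a set)) - 1 = 2 * (real n - 1)"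
    using arg_cong[OF dim_h, of real] by simp
  from lin_trace_conformal[OF linear_D \<omega>_D, unfolded this] show ?thesis
    by algebra
qed

text \<open>Every covector is a multiple of \<eta> plus one annihilating \<open>R\<close>, and its
  value at \<open>R\<close> is the multiple. So the condition just says \<eta>(D R) = - \<alpha> (n
  - 1), which is tr D = 0 by the trace formula.\<close>

lemma derivation_action_\<eta>_iff:
  "(\<exists>\<zeta>\<in>annihilator_forms (span {R}).
      derivation_action D \<eta> = (\<lambda>xs. - \<alpha> * (real n - 1) * \<eta> xs + \<zeta> xs)) \<longleftrightarrow> lin_trace D = 0"
proof
  assume "\<exists>\<zeta>\<in>annihilator_forms (span {R}).
      derivation_action D \<eta> = (\<lambda>xs. - \<alpha> * (real n - 1) * \<eta> xs + \<zeta> xs)"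
  then obtain \<zeta> where "\<zeta> \<in> annihilator_forms (span {R})"
    and D\<eta>: "derivation_action D \<eta> = (\<lambda>xs. - \<alpha> * (real n - 1) * \<eta> xs + \<zeta> xs)"
    by blast
  then have "\<zeta> [R] = 0"
    unfolding annihilator_forms_def by (simp add: span_base)
  with fun_cong[OF D\<eta>, of "[R]"] show "lin_trace D = 0"
    by (simp add: derivation_action_1 lin_trace_D \<eta>_R)
next
  assume tr: "lin_trace D = 0"
  \<comment> \<open>The required equation leaves no other choice for \<zeta>.\<close>
  define \<zeta> where "\<zeta> xs = derivation_action D \<eta> xs + \<alpha> * (real n - 1) * \<eta> xs" for xs
  have 1: "\<zeta> [x] = \<eta> [D x] + \<alpha> * (real n - 1) * \<eta> [x]" for x
    by (simp add: \<zeta>_def derivation_action_1)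
  have lin: "linear (\<lambda>x. \<zeta> [x])"
    unfolding 1 by (rule linearI) (simp_all add: \<eta>_simps D_simps algebra_simps)
  have "\<zeta> = covector_form (\<lambda>x. \<zeta> [x])"
  proof
    fix xs
    show "\<zeta> xs = covector_form (\<lambda>x. \<zeta> [x]) xs"
    proof (cases "length xs = 1")
      case True
      then show ?thesis
        by (auto simp: length_Suc_conv covector_form_def)
    next
      case False
      then have "\<eta> ys = 0" if "length ys = length xs" for ys
        using alt_\<eta> that unfolding alt_form_def by simp
      then show ?thesis
        using False by (simp add: \<zeta>_def covector_form_def derivation_action_def)
    qed
  qed
  then have "alt_form 1 \<zeta>"
    using alt_form_covector_form[OF lin] by simp
  moreover have "\<zeta> [x] = 0" if "x \<in> span {R}" for x
  proof -
    have "\<zeta> [R] = 0"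
      using tr by (simp add: 1 lin_trace_D \<eta>_R)
    then show ?thesis
      using that by (auto simp: span_singleton linear_scale[OF lin])
  qed
  ultimately have "\<zeta> \<in> annihilator_forms (span {R})"
    unfolding annihilator_forms_def by blast
  moreover have "derivation_action D \<eta> = (\<lambda>xs. - \<alpha> * (real n - 1) * \<eta> xs + \<zeta> xs)"
    by (simp add: \<zeta>_def fun_eq_iff)
  ultimately show "\<exists>\<zeta>\<in>annihilator_forms (span {R}).
      derivation_action D \<eta> = (\<lambda>xs. - \<alpha> * (real n - 1) * \<eta> xs + \<zeta> xs)"
    by blast
qed

lemma not_exact:
  assumes "unimodular_lie br"
  shows "\<not> lcs_exact brg \<Omega> \<theta>"
proof
  assume "lcs_exact brg \<Omega> \<theta>"
  then obtain \<upsilon> where alt_\<upsilon>: "alt_form 1 \<upsilon>"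
    and ex: "\<Omega> = (\<lambda>xs. ce_diff brg \<upsilon> xs - wedge_form \<theta> \<upsilon> xs)"
    unfolding lcs_exact_def by blast
  have lin_\<upsilon>: "linear (\<lambda>x. \<upsilon> [(x, 0)])"
  proof -
    have "linear (\<lambda>x::'a. (x, 0 :: real))"
      by (simp add: linear_iff)
    from linear_compose[OF this alt_form_1_linear[OF alt_\<upsilon>]] show ?thesis
      by (simp add: o_def)
  qed
  \<comment> \<open>On h the real components vanish, and with them \<theta>; exactness restricts to
    \<omega> = d\<upsilon>.\<close>
  have \<omega>_exact: "\<omega> [x, y] = - \<upsilon> [(br x y, 0)]" for x y
    using fun_cong[OF ex, of "[(x, 0), (y, 0)]"]
    by (simp add: \<Omega>_Pair ce_diff_2 brg_Pair wedge_form_1_1[OF alt_\<theta> alt_\<upsilon>] \<theta>_Pair)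
  \<comment> \<open>Subtracting the multiple of \<eta> makes the covector vanish at
    \<open>R\<close>, as its representation through \<omega> requires; commutators do not see the
    change, because \<eta> is closed.\<close>
  define \<mu> where "\<mu> y = \<upsilon> [(y, 0)] - \<upsilon> [(R, 0)] * \<eta> [y]" for y
  have "linear \<mu>"
    unfolding \<mu>_def by (rule linearI)
      (simp_all add: linear_add[OF lin_\<upsilon>] linear_scale[OF lin_\<upsilon>] \<eta>_simps algebra_simps)
  moreover have "\<mu> R = 0"
    by (simp add: \<mu>_def \<eta>_R)
  ultimately obtain x\<^sub>0 where x\<^sub>0: "\<And>y. \<omega> [x\<^sub>0, y] = \<mu> y"
    using covector_represented by blast
  \<comment> \<open>Closedness turns the left side into \<omega>(\<open>x\<^sub>0\<close>, [x, y]),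
    which is \<upsilon>([x, y]) = - \<omega>(x, y).\<close>
  have "\<omega> [br x\<^sub>0 x, y] + \<omega> [x, br x\<^sub>0 y] = - 1 * \<omega> [x, y]" for x y
    using \<omega>_closed[of x\<^sub>0 x y] \<omega>_swap[of x "br x\<^sub>0 y"] \<omega>_swap[of "br x y" x\<^sub>0] x\<^sub>0[of "br x y"]
      \<omega>_exact[of x y] by (simp add: \<mu>_def \<eta>_br)
  \<comment> \<open>Here a = - 1, the dimension minus 1 is 2n - 2, and the term with
    \<open>R\<close> vanishes since \<eta> kills commutators. The result is nonzero because n \<ge>
    2.\<close>
  from lin_trace_conformal[OF linear_br this] have "2 * lin_trace (br x\<^sub>0) = 2 - 2 * real n"
    using dim_h by (simp add: \<eta>_br)
  then show False
    using assms n unfolding unimodular_lie_def by simp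
qed

end

theorem proposition1p8:
  fixes n :: nat
    and br :: "'a::real_vector \<Rightarrow> 'a \<Rightarrow> 'a"
    and \<eta> \<omega> :: "'a list \<Rightarrow> real"
    and R :: 'a
    and D :: "'a \<Rightarrow> 'a"
    and \<alpha> :: real
    and brg :: "'a \<times> real \<Rightarrow> 'a \<times> real \<Rightarrow> 'a \<times> real"
    and \<theta> \<Omega> :: "('a \<times> real) list \<Rightarrow> real"
  assumes "n \<ge> 2"
    and "cosymplectic_structure n br \<eta> \<omega>"
    and "reeb_vector \<eta> \<omega> R"
    and "lie_derivation br D"
    and "\<alpha> \<noteq> 0"
    and "derivation_action D \<omega> = (\<lambda>xs. \<alpha> * \<omega> xs)"
    and "brg = semidirect_bracket br D"
    and "\<theta> = covector_form (\<lambda>(X, a). - \<alpha> * a)"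
    and "\<Omega> = (\<lambda>xs. pullback_form fst \<omega> xs + wedge_form (pullback_form fst \<eta>) \<theta> xs)"
  shows "lcs_structure n brg \<Omega> \<theta> \<and>
    (unimodular_lie brg \<longleftrightarrow>
       unimodular_lie br \<and>
       (\<exists>\<zeta>\<in>annihilator_forms (span {R}).
          derivation_action D \<eta> = (\<lambda>xs. - \<alpha> * (real n - 1) * \<eta> xs + \<zeta> xs))) \<and>
    (unimodular_lie br \<longrightarrow> \<not> lcs_exact brg \<Omega> \<theta>)"
proof -
  interpret H: cosymplectic_derivation n br \<eta> \<omega> R D \<alpha>
    by unfold_locales (use assms in auto)
  have "\<Omega> = H.\<Omega>"
    by (simp add: assms(8,9) H.\<Omega>_def H.\<theta>_def fun_eq_iff)
  moreover have "\<theta> = H.\<theta>"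
    by (simp add: assms(8) H.\<theta>_def)
  ultimately show ?thesis
    unfolding assms(7)
    using H.lcs H.unimodular_brg_iff H.derivation_action_\<eta>_iff H.not_exact by metis
qed

end
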